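(* Let $A$ be a semi-simple, regular and Tauberian commutative complex Banach algebra and let $T:A\to A$ be a multiplier of $A$. Then the following assertions are equivalent: (1) $T$ is Pseudo-Fredholm; (2) $T$ is generalized Drazin invertible.
   Context: A mapping $T:A\to A$ is a multiplier of $A$ if $T(x)y=xT(y)$ for all $x,y\in A$; it is well known that every multiplier of a semi-simple commutative Banach algebra is a bounded linear operator on $A$. Let $\Delta(A)$ be the Gelfand (character) space of $A$ and $\hat a$ the Gelfand transform of $a\in A$. $A$ is regular if for every closed $F\subseteq\Delta(A)$ and $\varphi\in\Delta(A)\setminus F$ there is $a\in A$ with $\hat a=0$ on $F$ and $\hat a(\varphi)\neq0$. $A$ is Tauberian if the set of $a\in A$ whose Gelfand transform has compact support is dense in $A$. For a bounded operator $T$ on a Banach space $X$, $N(T)$, $R(T)$ are the null space and range, and $R^{\infty}(T)=\bigcap_{n\ge 0}R(T^n)$. $T$ is semi-regular (Kato) if $R(T)$ is closed and $N(T)\subseteq R^\infty(T)$. $T$ is Pseudo-Fredholm (admits a generalized Kato decomposition) if there are $T$-invariant closed subspaces $M,N$ with $X=M\oplus N$, $T|_M$ semi-regular and $T|_N$ quasinilpotent (here $M=\{0\}$ or $N=\{0\}$ is allowed). $T$ is generalized Drazin invertible if $0$ is not an accumulation point of the spectrum $\sigma(T)$. *)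

theory Defs
  imports "HOL-Analysis.Analysis"
begin

section \<open>Complex Banach spaces and commutative complex Banach algebras\<close>

text \<open>
  The library classes \<^class>\<open>banach\<close> and \<^class>\<open>real_normed_algebra\<close> are real; the classes below add a
  compatible complex scalar multiplication. Algebras are not assumed to have a unit.
\<close>

class complex_banach = banach +
  fixes scaleC :: "complex \<Rightarrow> 'a \<Rightarrow> 'a"  (infixr \<open>*\<^sub>C\<close> 75)
  assumes scaleC_add_right: "c *\<^sub>C (x + y) = c *\<^sub>C x + c *\<^sub>C y"
    and scaleC_add_left: "(c + d) *\<^sub>C x = c *\<^sub>C x + d *\<^sub>C x"
    and scaleC_scaleC: "c *\<^sub>C (d *\<^sub>C x) = (c * d) *\<^sub>C x"
    and scaleR_scaleC: "r *\<^sub>R x = complex_of_real r *\<^sub>C x"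
    and norm_scaleC: "norm (c *\<^sub>C x) = cmod c * norm x"

class comm_complex_banach_algebra = complex_banach + real_normed_algebra + comm_ring +
  assumes mult_scaleC_left: "(c *\<^sub>C x) * y = c *\<^sub>C (x * y)"


section \<open>Gelfand theory\<close>

text \<open>
  The Gelfand topology on the character space is the topology of pointwise convergence. It is
  obtained here as the subspace topology inherited from the type \<^typ>\<open>'a \<Rightarrow> complex\<close>, on which
  the library puts the product topology. Continuity of characters is automatic.
\<close>

definition gelfand_space :: "('a::comm_complex_banach_algebra \<Rightarrow> complex) set" where
  "gelfand_space = {\<phi>. (\<forall>x y. \<phi> (x + y) = \<phi> x + \<phi> y) \<and> (\<forall>c x. \<phi> (c *\<^sub>C x) = c * \<phi> x) \<and>
     (\<forall>x y. \<phi> (x * y) = \<phi> x * \<phi> y) \<and> (\<exists>x. \<phi> x \<noteq> 0)}"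

abbreviation gelfand_topology :: "('a::comm_complex_banach_algebra \<Rightarrow> complex) topology" where
  "gelfand_topology \<equiv> top_of_set gelfand_space"

definition gelfand_transform ::
  "'a::comm_complex_banach_algebra \<Rightarrow> ('a \<Rightarrow> complex) \<Rightarrow> complex" where
  "gelfand_transform a \<phi> = \<phi> a"

text \<open>
  The radical is the intersection of the kernels of all characters (the whole algebra if there are
  no characters). Kernels of characters are exactly the maximal modular ideals.
\<close>

definition radical :: "'a::comm_complex_banach_algebra set" where
  "radical = (\<Inter>\<phi>\<in>gelfand_space. {a. \<phi> a = 0})"

definition semisimple_algebra :: "'a::comm_complex_banach_algebra itself \<Rightarrow> bool" where
  "semisimple_algebra _ \<longleftrightarrow> (radical :: 'a set) = {0}"

definition regular_algebra :: "'a::comm_complex_banach_algebra itself \<Rightarrow> bool" where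
  "regular_algebra _ \<longleftrightarrow>
     (\<forall>F (\<phi>::'a \<Rightarrow> complex). closedin gelfand_topology F \<longrightarrow> \<phi> \<in> gelfand_space - F \<longrightarrow>
        (\<exists>a. (\<forall>\<psi>\<in>F. gelfand_transform a \<psi> = 0) \<and> gelfand_transform a \<phi> \<noteq> 0))"

definition gelfand_support :: "'a::comm_complex_banach_algebra \<Rightarrow> ('a \<Rightarrow> complex) set" where
  "gelfand_support a =
     gelfand_topology closure_of {\<phi> \<in> gelfand_space. gelfand_transform a \<phi> \<noteq> 0}"

definition tauberian_algebra :: "'a::comm_complex_banach_algebra itself \<Rightarrow> bool" where
  "tauberian_algebra _ \<longleftrightarrow>
     closure {a::'a. compactin gelfand_topology (gelfand_support a)} = UNIV"

definition multiplier :: "('a::comm_complex_banach_algebra \<Rightarrow> 'a) \<Rightarrow> bool" where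
  "multiplier T \<longleftrightarrow> (\<forall>x y. T x * y = x * T y)"


section \<open>Operators on complex Banach spaces\<close>

definition bounded_clinear :: "('a::complex_banach \<Rightarrow> 'a) \<Rightarrow> bool" where
  "bounded_clinear S \<longleftrightarrow> bounded_linear S \<and> (\<forall>c x. S (c *\<^sub>C x) = c *\<^sub>C S x)"

definition op_spectrum :: "('a::complex_banach \<Rightarrow> 'a) \<Rightarrow> complex set" where
  "op_spectrum T = {\<mu>. \<not> (\<exists>S. bounded_clinear S \<and>
     (\<forall>x. S (T x - \<mu> *\<^sub>C x) = x) \<and> (\<forall>x. T (S x) - \<mu> *\<^sub>C S x = x))}"

definition generalized_drazin_invertible :: "('a::complex_banach \<Rightarrow> 'a) \<Rightarrow> bool" where
  "generalized_drazin_invertible T \<longleftrightarrow> \<not> (0 islimpt op_spectrum T)"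

definition closed_csubspace :: "'a::complex_banach set \<Rightarrow> bool" where
  "closed_csubspace M \<longleftrightarrow> closed M \<and> 0 \<in> M \<and> (\<forall>x\<in>M. \<forall>y\<in>M. x + y \<in> M) \<and>
     (\<forall>c. \<forall>x\<in>M. c *\<^sub>C x \<in> M)"

text \<open>
  The predicates with suffix \<open>_on\<close> speak about the restriction of \<open>T\<close> to a closed \<open>T\<close>-invariant
  subspace, viewed as an operator on that subspace.
\<close>

definition semi_regular_on :: "'a::complex_banach set \<Rightarrow> ('a \<Rightarrow> 'a) \<Rightarrow> bool" where
  "semi_regular_on M T \<longleftrightarrow>
     closedin (top_of_set M) (T ` M) \<and> {x \<in> M. T x = 0} \<subseteq> (\<Inter>n. (T ^^ n) ` M)"

definition op_norm_on :: "'a::complex_banach set \<Rightarrow> ('a \<Rightarrow> 'a) \<Rightarrow> real" where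
  "op_norm_on N T = (SUP x \<in> {x \<in> N. norm x \<le> 1}. norm (T x))"

definition quasinilpotent_on :: "'a::complex_banach set \<Rightarrow> ('a \<Rightarrow> 'a) \<Rightarrow> bool" where
  "quasinilpotent_on N T \<longleftrightarrow> (\<lambda>n. root n (op_norm_on N (T ^^ n))) \<longlonglongrightarrow> 0"

definition pseudo_fredholm :: "('a::complex_banach \<Rightarrow> 'a) \<Rightarrow> bool" where
  "pseudo_fredholm T \<longleftrightarrow>
     (\<exists>M N. closed_csubspace M \<and> closed_csubspace N \<and> T ` M \<subseteq> M \<and> T ` N \<subseteq> N \<and>
        M \<inter> N = {0} \<and> (\<forall>x. \<exists>u\<in>M. \<exists>v\<in>N. x = u + v) \<and>
        semi_regular_on M T \<and> quasinilpotent_on N T)"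

end

theory Submission imports Defs begin

text \<open>
  A multiplier \<open>T\<close> of a semisimple algebra acts on Gelfand transforms as multiplication by a function
  \<open>t\<close> on the character space, its symbol: \<open>\<phi> (T x) = t \<phi> * \<phi> x\<close>. Since characters separate
  points, algebraic identities between operators built from \<open>T\<close> need only be verified for the
  scalars \<open>t \<phi>\<close>. The two implications use this as follows.

  If \<open>0\<close> is not an accumulation point of the spectrum, the resolvent of \<open>T\<close> exists on a small circle
  around \<open>0\<close>. The mean of \<open>inverse (T - \<mu>) x\<close> over that circle is an element whose image under \<open>\<phi>\<close> is
  \<open>\<phi> x / t \<phi>\<close> if \<open>t \<phi> \<noteq> 0\<close> and \<open>0\<close> otherwise, because every non-zero value of the symbol lies in
  the spectrum and hence outside the circle (\<open>resolvent_average\<close>). So \<open>T\<close> has a generalized inverse,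
  and the algebra is the direct sum of the range of \<open>T\<close>, on which \<open>T\<close> is invertible, and the kernel
  of \<open>T\<close> (\<open>generalized_drazin_imp_pseudo_fredholm\<close>).

  Conversely, let \<open>M\<close> and \<open>N\<close> decompose \<open>T\<close>. On \<open>N\<close> the symbol forces the quasinilpotent operator \<open>T\<close>
  to vanish, and on \<open>M\<close> it forces the kernel, which consists of elements \<open>T y\<close> with \<open>T (T y) = 0\<close>,
  to be trivial. By the open mapping theorem \<open>T\<close> is then bounded below on \<open>M\<close>
  (\<open>pseudo_fredholm_multiplier_splitting\<close>). It remains to see that \<open>T\<close> maps \<open>M\<close> onto \<open>M\<close>, that is,
  that the ideal \<open>J\<close> spanned by the range and the kernel of \<open>T\<close> is dense. No character \<open>\<phi>\<close>
  vanishes on \<open>J\<close>: otherwise \<open>t \<phi> = 0\<close>, and regularity supplies an element with non-zero image under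
  \<open>T\<close> and Gelfand transform supported where the symbol is tiny. On the elements of the range with
  that support, \<open>T\<close> is bounded below, while \<open>T - \<nu>\<close> is invertible for some slightly larger \<open>\<nu>\<close>; by
  perturbation \<open>T - t \<psi>\<close> is onto there for a character \<open>\<psi>\<close> in the support, which is absurd because \<open>\<psi>\<close>
  annihilates the range of \<open>T - t \<psi>\<close> (\<open>multiplier_range_kernel_hull_empty\<close>). An ideal on which no
  character vanishes contains all elements with compactly supported Gelfand transform
  (\<open>compact_support_in_ideal\<close>), and by the Tauberian hypothesis these are dense. As \<open>T\<close> is bounded
  below on \<open>M\<close> with closed range, surjectivity on \<open>M\<close> follows, and \<open>T - \<mu>\<close> is bijective for
  all small \<open>\<mu> \<noteq> 0\<close>.

  The Gelfand theory behind this rests on one theorem: a proper modular ideal lies in the kernel of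
  a character (\<open>modular_ideal_character\<close>). Both its Gelfand-Mazur core and the resolvent means are
  obtained from averages over roots of unity; vector-valued contour integrals never appear, and
  quotient algebras are replaced by the seminorm \<open>infdist x I\<close>.
\<close>

section \<open>The open mapping and closed graph theorems\<close>

text \<open>
  The first half of the proof of the open mapping theorem: by the Baire category theorem the closure
  of the image of some ball of \<open>M\<close> has interior in the image of \<open>M\<close>, so every vector of the image can
  be halved by subtracting an \<open>f x\<close> with control on the norm of \<open>x\<close>.
\<close>

lemma open_mapping_approx:
  fixes f :: "'a::banach \<Rightarrow> 'b::banach"
  assumes "bounded_linear f" "closed M" "subspace M" "closed (f ` M)"
  obtains K where "K > 0" "\<And>y. y \<in> f ` M \<Longrightarrow> \<exists>x\<in>M. norm x \<le> K * norm y \<and> norm (y - f x) \<le> norm y / 2"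
proof -
  interpret f: bounded_linear f by fact
  define Z where "Z = f ` M"
  have Zsub: "subspace Z"
    unfolding Z_def using assms(3) f.linear_axioms by (rule linear_subspace_image[rotated])
  define G where "G n = closure (f ` (M \<inter> cball 0 (real n)))" for n
  have GZ: "G n \<subseteq> Z" for n
    unfolding G_def by (metis Z_def assms(4) closure_minimal image_mono inf_le1)
  have "Z \<subseteq> (\<Union>n. G n)"
  proof
    fix z assume "z \<in> Z"
    then obtain x where x: "x \<in> M" "z = f x" unfolding Z_def by auto
    obtain n where "norm x \<le> real n" using real_arch_simple by blast
    then have "z \<in> G n" unfolding G_def using x by (intro closure_subset[THEN subsetD]) auto
    then show "z \<in> (\<Union>n. G n)" by blast
  qed
  with GZ have UG: "\<Union>(range G) = Z" by blast
  have cm: "completely_metrizable_space (top_of_set Z)"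
    using assms(4) completely_metrizable_space_closedin[OF completely_metrizable_space_euclidean]
    unfolding Z_def by simp
  have cG: "closedin (top_of_set Z) (G n)" for n
    by (rule closed_subset[OF GZ]) (simp add: G_def)
  have "\<exists>n. (top_of_set Z) interior_of (G n) \<noteq> {}"
  proof (rule ccontr)
    assume "\<not> ?thesis"
    then have "(top_of_set Z) interior_of (\<Union>(range G)) = {}"
      using cm cG by (subst Baire_category_alt) auto
    then have "Z = {}" using UG interior_of_topspace[of "top_of_set Z"] by simp
    then show False using subspace_0[OF Zsub] by blast
  qed
  then obtain n y0 where "y0 \<in> (top_of_set Z) interior_of (G n)" by blast
  then obtain U where U: "openin (top_of_set Z) U" "y0 \<in> U" "U \<subseteq> G n"
    by (auto simp: interior_of_def)
  then obtain e where e: "e > 0" "ball y0 e \<inter> Z \<subseteq> U" "y0 \<in> Z"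
    by (metis openin_contains_ball subset_iff)
  \<comment> \<open>The summand 1 only serves to make the constant positive when the index is 0.\<close>
  define K where "K = (2 * real n + 1) * 2 / e"
  have Kpos: "K > 0" unfolding K_def using e by simp
  have small: "\<exists>x\<in>M. norm x \<le> 2 * real n \<and> norm (z - f x) < d"
    if z: "z \<in> Z" "norm z < e" and d: "d > 0" for z d
  proof -
    have "y0 + z \<in> ball y0 e \<inter> Z" using z e(3) Zsub by (auto simp: dist_norm subspace_add)
    then have "y0 + z \<in> G n" using e U by blast
    then obtain x1 where x1: "x1 \<in> M" "norm x1 \<le> real n" "dist (f x1) (y0 + z) < d/2"
      unfolding G_def closure_approachable using d half_gt_zero[OF d] by fastforce
    have "y0 \<in> G n" using U by blast
    then obtain x2 where x2: "x2 \<in> M" "norm x2 \<le> real n" "dist (f x2) y0 < d/2"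
      unfolding G_def closure_approachable using d half_gt_zero[OF d] by fastforce
    have "norm (z - f (x1 - x2)) = norm ((f x2 - y0) - (f x1 - (y0 + z)))"
      by (simp add: f.diff algebra_simps)
    also have "\<dots> < d" using x1(3) x2(3) norm_triangle_ineq4[of "f x2 - y0" "f x1 - (y0 + z)"]
      by (simp add: dist_norm)
    finally show ?thesis using x1 x2 assms(3) norm_triangle_ineq4[of x1 x2]
      by (intro bexI[of _ "x1 - x2"]) (auto simp: subspace_diff)
  qed
  show ?thesis
  proof (rule that[OF Kpos])
    fix y assume "y \<in> f ` M"
    then have y: "y \<in> Z" unfolding Z_def .
    show "\<exists>x\<in>M. norm x \<le> K * norm y \<and> norm (y - f x) \<le> norm y / 2"
    proof (cases "y = 0")
      case True then show ?thesis using subspace_0[OF assms(3)] by (intro bexI[of _ 0]) (auto simp: f.zero)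
    next
      case False
      define s where "s = e / (2 * norm y)"
      have s: "s > 0" unfolding s_def using False e by simp
      have "norm (s *\<^sub>R y) = e / 2" unfolding s_def using False e by simp
      then obtain x where x: "x \<in> M" "norm x \<le> 2 * real n" "norm (s *\<^sub>R y - f x) < s * norm y / 2"
        using small[of "s *\<^sub>R y" "s * norm y / 2"] y Zsub e s False by (auto simp: subspace_scale)
      have "y - f (x /\<^sub>R s) = (s *\<^sub>R y - f x) /\<^sub>R s" using s by (simp add: f.scaleR scaleR_right_diff_distrib)
      then have "norm (y - f (x /\<^sub>R s)) = norm (s *\<^sub>R y - f x) / s" using s by (simp add: divide_inverse mult.commute)
      also have "\<dots> \<le> norm y / 2" using x(3) s by (simp add: field_simps)
      finally have 1: "norm (y - f (x /\<^sub>R s)) \<le> norm y / 2" .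
      have "norm (x /\<^sub>R s) = norm x / s" using s by (simp add: divide_inverse mult.commute)
      also have "\<dots> \<le> (2 * real n + 1) / s" using x(2) s by (intro divide_right_mono) auto
      also have "\<dots> = K * norm y" unfolding s_def K_def using e False by (simp add: field_simps)
      finally show ?thesis using 1 x(1) assms(3) by (intro bexI[of _ "x /\<^sub>R s"]) (auto simp: subspace_scale)
    qed
  qed
qed

text \<open>
  Iterating the previous approximation gives a geometric series of preimages. Stating the theorem
  for a closed subspace \<open>M\<close> covers restrictions of operators as well as projections of graphs.
\<close>

lemma open_mapping_bound:
  fixes f :: "'a::banach \<Rightarrow> 'b::banach"
  assumes "bounded_linear f" "closed M" "subspace M" "closed (f ` M)"
  obtains C where "C > 0" "\<And>y. y \<in> f ` M \<Longrightarrow> \<exists>x\<in>M. f x = y \<and> norm x \<le> C * norm y"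
proof -
  interpret f: bounded_linear f by fact
  obtain K where K: "K > 0" "\<And>y. y \<in> f ` M \<Longrightarrow> \<exists>x\<in>M. norm x \<le> K * norm y \<and> norm (y - f x) \<le> norm y / 2"
    using open_mapping_approx[OF assms] by blast
  have Zsub: "subspace (f ` M)"
    using assms(3) f.linear_axioms by (rule linear_subspace_image[rotated])
  obtain g where g: "\<And>y. y \<in> f ` M \<Longrightarrow> g y \<in> M \<and> norm (g y) \<le> K * norm y \<and> norm (y - f (g y)) \<le> norm y / 2"
    using K(2) by metis
  show ?thesis
  proof (rule that[of "2 * K"])
    show "2 * K > 0" using K by simp
    fix y assume y: "y \<in> f ` M"
    \<comment> \<open>The remainder after \<open>k\<close> corrections.\<close>
    define r where "r k = ((\<lambda>v. v - f (g v)) ^^ k) y" for k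
    have r_Suc: "r (Suc k) = r k - f (g (r k))" for k unfolding r_def by simp
    have rZ: "r k \<in> f ` M" for k
    proof (induction k)
      case 0 then show ?case using y by (simp add: r_def)
    next
      case (Suc k) then show ?case unfolding r_Suc using g Zsub by (blast intro: subspace_diff)
    qed
    have rn: "norm (r k) \<le> norm y * (1/2) ^ k" for k
    proof (induction k)
      case 0 then show ?case by (simp add: r_def)
    next
      case (Suc k) then show ?case using g[OF rZ[of k]] by (simp add: r_Suc)
    qed
    have gn: "norm (g (r k)) \<le> K * norm y * (1/2) ^ k" for k
    proof -
      have "norm (g (r k)) \<le> K * norm (r k)" using g[OF rZ[of k]] by blast
      also have "\<dots> \<le> K * (norm y * (1/2) ^ k)" using rn[of k] K(1) by (intro mult_left_mono) auto
      finally show ?thesis by (simp add: mult.assoc)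
    qed
    have geo: "(\<lambda>k. K * norm y * (1/2) ^ k) sums (K * norm y * 2)"
      using sums_mult[OF geometric_sums[of "1/2::real"], of "K * norm y"] by simp
    have sn: "summable (\<lambda>k. norm (g (r k)))"
      by (rule summable_comparison_test'[OF sums_summable[OF geo], of 0]) (simp add: gn)
    define x where "x = (\<Sum>k. g (r k))"
    have sm: "(\<lambda>k. g (r k)) sums x" unfolding x_def using summable_norm_cancel[OF sn] by (rule summable_sums)
    have "(\<Sum>k<n. g (r k)) \<in> M" for n using g rZ assms(3) by (intro subspace_sum) auto
    then have xM: "x \<in> M" using sm assms(2) unfolding sums_def by (metis closed_sequentially)
    have "norm x \<le> (\<Sum>k. norm (g (r k)))" unfolding x_def by (rule summable_norm[OF sn])
    also have "\<dots> \<le> (\<Sum>k. K * norm y * (1/2) ^ k)" by (rule suminf_le[OF gn sn sums_summable[OF geo]])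
    also have "\<dots> = 2 * K * norm y" using sums_unique[OF geo] by simp
    finally have nx: "norm x \<le> 2 * K * norm y" .
    have "(\<lambda>n. norm y * (1/2) ^ n) \<longlonglongrightarrow> norm y * 0" by (intro tendsto_intros) auto
    then have "r \<longlonglongrightarrow> 0" by (intro Lim_null_comparison[of r "\<lambda>n. norm y * (1/2) ^ n"]) (auto simp: rn)
    then have "(\<lambda>k. r k - r (Suc k)) sums (r 0 - 0)" by (rule telescope_sums')
    then have "(\<lambda>k. f (g (r k))) sums y" by (simp add: r_Suc r_def[of 0])
    moreover have "(\<lambda>k. f (g (r k))) sums f x" using f.sums[OF sm] .
    ultimately have "f x = y" using sums_unique2 by blast
    then show "\<exists>x\<in>M. f x = y \<and> norm x \<le> 2 * K * norm y" using xM nx by blast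
  qed
qed

text \<open>
  The projection of the closed graph onto the first factor is onto, so it has bounded preimages.
\<close>

lemma closed_graph_bounded_linear:
  fixes T :: "'a::banach \<Rightarrow> 'b::banach"
  assumes lin: "linear T"
    and graph: "\<And>x l m. x \<longlonglongrightarrow> l \<Longrightarrow> (\<lambda>n. T (x n)) \<longlonglongrightarrow> m \<Longrightarrow> T l = m"
  shows "bounded_linear T"
proof -
  define M where "M = {(x, T x) | x. True}"
  have "closed M"
    unfolding closed_sequential_limits
  proof (intro allI impI)
    fix p l assume "(\<forall>n. p n \<in> M) \<and> p \<longlonglongrightarrow> l"
    then have pM: "p n \<in> M" and l: "p \<longlonglongrightarrow> l" for n by auto
    have p: "snd (p n) = T (fst (p n))" for n using pM[of n] unfolding M_def by auto
    have "T (fst l) = snd l"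
      using graph[OF tendsto_fst[OF l]] tendsto_snd[OF l] by (simp add: p)
    then show "l \<in> M" unfolding M_def by (metis (mono_tags, lifting) mem_Collect_eq prod.collapse)
  qed
  moreover have "subspace M"
    unfolding subspace_def M_def by (auto simp: linear_0[OF lin] linear_add[OF lin] linear_scale[OF lin] zero_prod_def)
  moreover have fM: "fst ` M = UNIV" unfolding M_def by force
  ultimately obtain C where "C > 0" and C: "\<And>y. \<exists>x\<in>M. fst x = y \<and> norm x \<le> C * norm y"
    using open_mapping_bound[OF bounded_linear_fst, of M] by (metis UNIV_I closed_UNIV)
  have "norm (T y) \<le> norm y * C" for y
  proof -
    obtain x where x: "x \<in> M" "fst x = y" "norm x \<le> C * norm y" using C by blast
    then have "snd x = T y" unfolding M_def by auto
    then show ?thesis using x(3) by (metis norm_snd_le prod.collapse order_trans mult.commute)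
  qed
  then show ?thesis using lin by (auto simp: bounded_linear_def bounded_linear_axioms_def)
qed


section \<open>Complex scalars and the quotient seminorm of a closed subspace\<close>

lemma scaleC_one [simp]: "1 *\<^sub>C (x::'a::complex_banach) = x"
  using scaleR_scaleC[of 1 x] by simp

lemma scaleC_0_left [simp]: "0 *\<^sub>C (x::'a::complex_banach) = 0"
  using scaleR_scaleC[of 0 x] by simp

lemma scaleC_0_right [simp]: "c *\<^sub>C (0::'a::complex_banach) = 0"
  using scaleC_add_right[of c 0 0] by simp

lemma scaleC_minus_left: "(- c) *\<^sub>C (x::'a::complex_banach) = - (c *\<^sub>C x)"
  using scaleC_add_left[of c "-c" x] by (simp add: minus_unique)

lemma scaleC_minus_right: "c *\<^sub>C (- x::'a::complex_banach) = - (c *\<^sub>C x)"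
  using scaleC_add_right[of c x "-x"] by (simp add: minus_unique)

lemma scaleC_diff_left: "(c - d) *\<^sub>C (x::'a::complex_banach) = c *\<^sub>C x - d *\<^sub>C x"
  using scaleC_add_left[of c "-d" x] by (simp add: scaleC_minus_left)

lemma scaleC_diff_right: "c *\<^sub>C (x - y::'a::complex_banach) = c *\<^sub>C x - c *\<^sub>C y"
  using scaleC_add_right[of c x "-y"] by (simp add: scaleC_minus_right)

lemma scaleC_sum_right: "c *\<^sub>C (\<Sum>i\<in>S. f i) = (\<Sum>i\<in>S. c *\<^sub>C (f i :: 'a::complex_banach))"
  by (induction S rule: infinite_finite_induct) (simp_all add: scaleC_add_right)

lemma scaleC_sum_left: "(\<Sum>i\<in>S. f i) *\<^sub>C (x::'a::complex_banach) = (\<Sum>i\<in>S. f i *\<^sub>C x)"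
  by (induction S rule: infinite_finite_induct) (simp_all add: scaleC_add_left)

lemma mult_scaleC_right: "x * (c *\<^sub>C y) = c *\<^sub>C (x * (y::'a::comm_complex_banach_algebra))"
  by (metis mult.commute mult_scaleC_left)

lemma bounded_linear_scaleC: "bounded_linear (\<lambda>x. c *\<^sub>C (x::'a::complex_banach))"
  by (rule bounded_linear_intro[where K="cmod c"])
     (auto simp: scaleC_add_right scaleR_scaleC scaleC_scaleC norm_scaleC mult.commute)

lemma closed_csubspace_subspace: "closed_csubspace M \<Longrightarrow> subspace M"
  unfolding closed_csubspace_def subspace_def by (simp add: scaleR_scaleC)

lemma closed_csubspaceD:
  assumes "closed_csubspace M"
  shows "closed M" "0 \<in> M" "x \<in> M \<Longrightarrow> y \<in> M \<Longrightarrow> x + y \<in> M" "x \<in> M \<Longrightarrow> c *\<^sub>C x \<in> M"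
    "x \<in> M \<Longrightarrow> y \<in> M \<Longrightarrow> x - y \<in> M"
  using assms subspace_diff[OF closed_csubspace_subspace[OF assms]] unfolding closed_csubspace_def by auto

lemma closed_csubspace_zero: "closed_csubspace {0}"
  unfolding closed_csubspace_def by auto

text \<open>
  The distance to a closed subspace \<open>H\<close> is the norm of the quotient by \<open>H\<close>. Working with this
  seminorm on the ambient space replaces the construction of quotient spaces and quotient algebras.
\<close>

lemma quotient_norm_le: "h \<in> H \<Longrightarrow> infdist x H \<le> norm (x - h)"
  by (metis dist_norm infdist_le)

lemma quotient_norm_approx:
  assumes "H \<noteq> {}" "e > (0::real)"
  obtains h where "h \<in> H" "norm (x - h) < infdist x H + e"
proof -
  have "\<exists>h\<in>H. dist x h < infdist x H + e"
  proof (rule ccontr)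
    assume "\<not> ?thesis"
    then have "infdist x H + e \<le> (INF a\<in>H. dist x a)"
      using assms(1) by (intro cINF_greatest) (auto simp: not_less)
    then show False using assms by (simp add: infdist_notempty)
  qed
  then show ?thesis using that by (auto simp: dist_norm)
qed

lemma quotient_norm_le_norm: "closed_csubspace H \<Longrightarrow> infdist x H \<le> norm x"
  using quotient_norm_le[of 0 H x] by (simp add: closed_csubspaceD)

lemma quotient_norm_eq_0: "closed_csubspace H \<Longrightarrow> infdist x H = 0 \<longleftrightarrow> x \<in> H"
  using in_closed_iff_infdist_zero[of H x] closed_csubspaceD(1,2)[of H] by auto

lemma quotient_norm_add:
  assumes "closed_csubspace H"
  shows "infdist (x + y) H \<le> infdist x H + infdist y H"
proof (rule field_le_epsilon)
  fix e :: real assume "e > 0"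
  obtain h where h: "h \<in> H" "norm (x - h) < infdist x H + e/2"
    using quotient_norm_approx[of H "e/2" x] \<open>e > 0\<close> closed_csubspaceD(2)[OF assms] by (metis emptyE half_gt_zero)
  obtain k where k: "k \<in> H" "norm (y - k) < infdist y H + e/2"
    using quotient_norm_approx[of H "e/2" y] \<open>e > 0\<close> closed_csubspaceD(2)[OF assms] by (metis emptyE half_gt_zero)
  have "infdist (x + y) H \<le> norm ((x - h) + (y - k))"
    using quotient_norm_le[of "h + k" H "x + y"] h k assms by (simp add: closed_csubspaceD algebra_simps)
  then show "infdist (x + y) H \<le> infdist x H + infdist y H + e"
    using norm_triangle_ineq[of "x - h" "y - k"] h k by simp
qed

lemma quotient_norm_cong:
  assumes "closed_csubspace H" "x - y \<in> H"
  shows "infdist x H = infdist y H"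
proof -
  have "infdist (x - y) H = 0" "infdist (y - x) H = 0"
    using assms closed_csubspaceD(5)[OF assms(1) closed_csubspaceD(2)[OF assms(1)] assms(2)]
    by (auto simp: quotient_norm_eq_0)
  then show ?thesis
    using quotient_norm_add[OF assms(1), of "x - y" y] quotient_norm_add[OF assms(1), of "y - x" x] by simp
qed

lemma quotient_norm_bounded_linear:
  assumes "bounded_linear S" "S ` H \<subseteq> H" "closed_csubspace H"
  shows "infdist (S x) H \<le> onorm S * infdist x H"
proof (rule field_le_epsilon)
  fix e :: real assume "e > 0"
  interpret S: bounded_linear S by fact
  define d where "d = e / (onorm S + 1)"
  have S0: "onorm S \<ge> 0" using onorm_pos_le[OF assms(1)] .
  have d: "d > 0" "onorm S * d \<le> e" unfolding d_def using S0 \<open>e > 0\<close> by (auto simp: field_simps)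
  obtain h where h: "h \<in> H" "norm (x - h) < infdist x H + d"
    using quotient_norm_approx[of H d x] d closed_csubspaceD(2)[OF assms(3)] by (metis emptyE)
  have "infdist (S x) H \<le> norm (S (x - h))"
    using quotient_norm_le[of "S h" H "S x"] h assms(2) by (auto simp: S.diff)
  also have "\<dots> \<le> onorm S * norm (x - h)" using onorm[OF assms(1)] .
  also have "\<dots> \<le> onorm S * (infdist x H + d)" using h S0 by (intro mult_left_mono) auto
  also have "\<dots> \<le> onorm S * infdist x H + e" using d by (simp add: algebra_simps)
  finally show "infdist (S x) H \<le> onorm S * infdist x H + e" .
qed

lemma quotient_norm_scaleC:
  assumes "closed_csubspace H"
  shows "infdist (c *\<^sub>C x) H = cmod c * infdist x H"
proof -
  have le: "infdist (c *\<^sub>C x) H \<le> cmod c * infdist x H" for c x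
  proof -
    have "onorm (\<lambda>x. c *\<^sub>C (x::'a)) \<le> cmod c" by (rule onorm_bound) (auto simp: norm_scaleC)
    then show ?thesis
      using quotient_norm_bounded_linear[OF bounded_linear_scaleC _ assms, of c x] closed_csubspaceD(4)[OF assms]
      by (meson image_subsetI infdist_nonneg mult_right_mono order_trans)
  qed
  show ?thesis
  proof (cases "c = 0")
    case True then show ?thesis using assms by (simp add: quotient_norm_eq_0 closed_csubspaceD)
  next
    case False
    have "infdist x H \<le> infdist (c *\<^sub>C x) H / cmod c"
      using le[of "inverse c" "c *\<^sub>C x"] False by (simp add: scaleC_scaleC norm_inverse divide_inverse mult.commute)
    then show ?thesis using le[of c x] False by (simp add: field_simps)
  qed
qed

lemma quotient_norm_minus_commute: "closed_csubspace H \<Longrightarrow> infdist (x - y) H = infdist (y - x) H"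
  using quotient_norm_scaleC[of H "-1" "x - y"] by (simp add: scaleC_minus_left)

lemma quotient_norm_triangle:
  "closed_csubspace H \<Longrightarrow> infdist (x - z) H \<le> infdist (x - y) H + infdist (y - z) H"
  using quotient_norm_add[of H "x - y" "y - z"] by simp

lemma quotient_norm_sum:
  assumes "closed_csubspace H"
  shows "infdist (\<Sum>i\<in>S. f i) H \<le> (\<Sum>i\<in>S. infdist (f i) H)"
proof (induction S rule: infinite_finite_induct)
  case (insert i S)
  then show ?case using quotient_norm_add[OF assms, of "f i" "sum f S"] by simp
qed (use quotient_norm_eq_0[OF assms] closed_csubspaceD(2)[OF assms] in auto)

text \<open>
  The quotient of a Banach space by a closed subspace is complete. The limit is found by choosing
  representatives of the differences along a rapidly converging subsequence; hence the conclusion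
  only speaks of a subsequence, which suffices to identify values of functionals.
\<close>

lemma quotient_norm_complete:
  fixes a :: "nat \<Rightarrow> 'a::complex_banach"
  assumes H: "closed_csubspace H"
    and cauchy: "\<And>e. e > 0 \<Longrightarrow> \<exists>N. \<forall>m\<ge>N. \<forall>n\<ge>N. infdist (a m - a n) H < e"
  obtains x g where "strict_mono (g :: nat \<Rightarrow> nat)" "(\<lambda>k. infdist (a (g k) - x) H) \<longlonglongrightarrow> 0"
proof -
  obtain N where N: "\<And>k m n. m \<ge> N k \<Longrightarrow> n \<ge> N k \<Longrightarrow> infdist (a m - a n) H < (1/2::real) ^ k"
    using cauchy[of "(1/2::real) ^ k" for k] by (metis zero_less_divide_1_iff zero_less_numeral zero_less_power)
  define g where "g k = k + (\<Sum>i\<le>k. N i)" for k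
  have g: "strict_mono g" unfolding strict_mono_Suc_iff g_def by simp
  have gN: "g k \<ge> N k" for k
    unfolding g_def using member_le_sum[of k "{..k}" N] by simp
  have "infdist (a (g (Suc k)) - a (g k)) H < (1/2) ^ k" for k
    using N[of k "g (Suc k)" "g k"] gN[of k] strict_monoD[OF g, of k "Suc k"] by linarith
  then have "\<exists>h\<in>H. norm (a (g (Suc k)) - a (g k) - h) < 2 * (1/2) ^ k" for k
    using quotient_norm_approx[of H "(1/2) ^ k" "a (g (Suc k)) - a (g k)"] closed_csubspaceD(2)[OF H]
    by (smt (verit, best) emptyE zero_less_divide_1_iff zero_less_power)
  then obtain h where h: "\<And>k. h k \<in> H" "\<And>k. norm (a (g (Suc k)) - a (g k) - h k) < 2 * (1/2) ^ k"
    by metis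
  define b where "b k = a (g (Suc k)) - a (g k) - h k" for k
  have "summable (\<lambda>k. 2 * (1/2::real) ^ k)" by (intro summable_mult summable_geometric) simp
  then have "summable (\<lambda>k. norm (b k))"
    by (rule summable_comparison_test'[of _ 0]) (use h(2) in \<open>auto simp: b_def intro: less_imp_le\<close>)
  then obtain s where s: "b sums s" using summable_norm_cancel by blast
  define x where "x = a (g 0) + s"
  have part: "a (g k) - (a (g 0) + (\<Sum>i<k. b i)) = (\<Sum>i<k. h i)" for k
    by (induction k) (auto simp: b_def algebra_simps)
  have hs: "(\<Sum>i<k. h i) \<in> H" for k
    using h(1) closed_csubspace_subspace[OF H] by (intro subspace_sum) auto
  have eq: "infdist (a (g k) - x) H \<le> norm ((\<Sum>i<k. b i) - s)" for k
  proof -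
    have "infdist (a (g k) - x) H \<le> norm (a (g k) - x - (\<Sum>i<k. h i))"
      using hs by (rule quotient_norm_le)
    also have "a (g k) - x - (\<Sum>i<k. h i) = (\<Sum>i<k. b i) - s"
      using part[of k] by (simp add: x_def algebra_simps)
    finally show ?thesis .
  qed
  have "(\<lambda>k. norm ((\<Sum>i<k. b i) - s)) \<longlonglongrightarrow> 0"
    using s unfolding sums_def by (metis LIM_zero tendsto_norm_zero)
  then have "(\<lambda>k. infdist (a (g k) - x) H) \<longlonglongrightarrow> 0"
    by (rule tendsto_sandwich[OF _ _ tendsto_const, rotated 2]) (auto simp: eq infdist_nonneg)
  with g show ?thesis using that by blast
qed

section \<open>Averages over roots of unity\<close>

definition unity_root :: "nat \<Rightarrow> nat \<Rightarrow> complex" where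
  "unity_root n k = cis (2 * pi * real k / real n)"

lemma norm_unity_root [simp]: "cmod (unity_root n k) = 1"
  by (simp add: unity_root_def)

lemma unity_root_0 [simp]: "unity_root n 0 = 1"
  by (simp add: unity_root_def)

lemma unity_root_power_n: "n > 0 \<Longrightarrow> unity_root n k ^ n = 1"
  unfolding unity_root_def Complex.DeMoivre by (simp add: cis_multiple_2pi)

text \<open>
  A geometric sum whose ratio is an \<open>n\<close>-th root of unity other than \<open>1\<close>.
\<close>

lemma sum_unity_root_power:
  assumes "0 < j" "j < n"
  shows "(\<Sum>k<n. unity_root n k ^ j) = 0"
proof -
  define z where "z = unity_root n j"
  have pow: "unity_root n k ^ j = z ^ k" for k
    unfolding z_def unity_root_def Complex.DeMoivre by (simp add: mult_ac)
  have "z \<noteq> 1"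
  proof
    assume "z = 1"
    then obtain m :: int where m: "2 * pi * real j / real n = 2 * pi * of_int m"
      unfolding z_def unity_root_def cis_conv_exp exp_eq_1 by auto
    then have "real j = of_int m * real n" using assms by (simp add: field_simps)
    then have jm: "int j = m * int n" by (metis of_int_eq_iff of_int_mult of_int_of_nat_eq)
    then have "int n dvd int j" by simp
    then have "n dvd j" by simp
    then show False using assms by (auto dest: dvd_imp_le)
  qed
  moreover have "z ^ n = 1" unfolding z_def using assms by (intro unity_root_power_n) simp
  ultimately show ?thesis unfolding pow using geometric_sum[of z n] by simp
qed


lemma cmod_cis_diff_le: "cmod (cis a - cis b) \<le> \<bar>a - b\<bar>"
proof -
  have "cis a - cis b = cis b * (cis (a - b) - 1)"
    by (simp add: right_diff_distrib cis_mult)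
  then have "cis a - cis b = cis b * (exp (\<i> * of_real (a - b)) - 1)"
    by (simp only: cis_conv_exp)
  then have "cmod (cis a - cis b) = 2 * \<bar>sin ((a - b) / 2)\<bar>"
    by (simp add: norm_mult dist_exp_i_1 del: of_real_diff)
  also have "\<dots> \<le> \<bar>a - b\<bar>" using abs_sin_x_le_abs_x[of "(a - b) / 2"] by simp
  finally show ?thesis .
qed

text \<open>
  Scalars are a complex Banach space, so the averages below apply to functions with values in \<open>\<complex>\<close>
  and to functions with values in an algebra alike.
\<close>

instantiation complex :: complex_banach
begin

definition scaleC_complex :: "complex \<Rightarrow> complex \<Rightarrow> complex" where
  "scaleC_complex c z = c * z"

instance
  by standard (auto simp: scaleC_complex_def algebra_simps norm_mult scaleR_conv_of_real)

end

definition circle_average :: "nat \<Rightarrow> real \<Rightarrow> (complex \<Rightarrow> 'a::complex_banach) \<Rightarrow> 'a" where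
  "circle_average n r f = (1 / of_nat n) *\<^sub>C (\<Sum>k<n. f (of_real r * unity_root n k))"

lemma circle_average_diff: "circle_average n r (\<lambda>\<mu>. f \<mu> - g \<mu>) = circle_average n r f - circle_average n r g"
  by (simp add: circle_average_def sum_subtractf scaleC_diff_right)

lemma circle_average_linear:
  assumes add: "\<And>x y. P (x + y) = P x + P y" and scale: "\<And>c x. P (c *\<^sub>C x) = c *\<^sub>C P x"
  shows "P (circle_average n r f) = circle_average n r (\<lambda>\<mu>. P (f \<mu>))"
proof -
  have "P 0 = 0" using add[of 0 0] by simp
  then have "P (\<Sum>k\<in>S. g k) = (\<Sum>k\<in>S. P (g k))" for g and S :: "nat set"
    by (induction S rule: infinite_finite_induct) (simp_all add: add)
  then show ?thesis unfolding circle_average_def scale by simp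
qed

text \<open>
  Averages over \<open>n\<close>-th roots of unity have the mean value property exactly, not only in the limit, for
  polynomials of degree less than \<open>n\<close>.
\<close>

lemma circle_average_polynomial:
  assumes "n > 0"
  shows "circle_average n r (\<lambda>\<mu>. \<Sum>j<n. \<mu> ^ j *\<^sub>C c j) = c 0"
proof -
  have "(\<Sum>k<n. \<Sum>j<n. (of_real r * unity_root n k) ^ j *\<^sub>C c j)
      = (\<Sum>j<n. (of_real r ^ j * (\<Sum>k<n. unity_root n k ^ j)) *\<^sub>C c j)"
    by (subst sum.swap) (simp add: power_mult_distrib sum_distrib_left scaleC_sum_left)
  also have "\<dots> = (\<Sum>j<n. if j = 0 then of_nat n *\<^sub>C c 0 else 0)"
    by (intro sum.cong refl) (auto simp: sum_unity_root_power)
  also have "\<dots> = of_nat n *\<^sub>C c 0" using assms by simp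
  finally show ?thesis using assms by (simp add: circle_average_def scaleC_scaleC)
qed

text \<open>
  A function with \<open>f \<mu> = a + \<mu> P (f \<mu>)\<close> is a resolvent of the operator \<open>P\<close>. Unfolding the equation
  \<open>n\<close> times turns \<open>f\<close> into a polynomial of degree less than \<open>n\<close> plus the remainder \<open>\<mu>\<^sup>n P\<^sup>n (f \<mu>)\<close>,
  and \<open>\<mu>\<^sup>n\<close> is constant on the points of the average. All equations hold modulo \<open>H\<close>.
\<close>

lemma circle_average_resolvent:
  assumes H: "closed_csubspace H" and r: "r \<ge> 0" and n: "n > 0"
    and add: "\<And>x y. P (x + y) = P x + P y" and scale: "\<And>c x. P (c *\<^sub>C x) = c *\<^sub>C P x"
    and PH: "P ` H \<subseteq> H"
    and f: "\<And>\<mu>. cmod \<mu> = r \<Longrightarrow> f \<mu> - (a + \<mu> *\<^sub>C P (f \<mu>)) \<in> H"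
  shows "circle_average n r f - (a + of_real (r ^ n) *\<^sub>C (P ^^ n) (circle_average n r f)) \<in> H"
proof -
  have P0: "P 0 = 0" using add[of 0 0] by simp
  have Pdiff: "P (x - y) = P x - P y" for x y using add[of "x - y" y] by simp
  have addn: "(P ^^ j) (x + y) = (P ^^ j) x + (P ^^ j) y" for j x y by (induction j) (simp_all add: add)
  have scalen: "(P ^^ j) (c *\<^sub>C x) = c *\<^sub>C (P ^^ j) x" for j c x by (induction j) (simp_all add: scale)
  have PHn: "x \<in> H \<Longrightarrow> (P ^^ j) x \<in> H" for j x by (induction j) (use PH in auto)
  have expand: "f \<mu> - ((\<Sum>j<m. \<mu> ^ j *\<^sub>C (P ^^ j) a) + \<mu> ^ m *\<^sub>C (P ^^ m) (f \<mu>)) \<in> H" if "cmod \<mu> = r" for \<mu> m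
  proof (induction m)
    case 0 then show ?case using H by (simp add: closed_csubspaceD)
  next
    case (Suc m)
    have "\<mu> ^ m *\<^sub>C (P ^^ m) (f \<mu> - (a + \<mu> *\<^sub>C P (f \<mu>))) \<in> H"
      using PHn[OF f[OF that]] H by (blast intro: closed_csubspaceD)
    moreover have "(P ^^ m) (f \<mu> - (a + \<mu> *\<^sub>C P (f \<mu>))) = (P ^^ m) (f \<mu>) - ((P ^^ m) a + \<mu> *\<^sub>C (P ^^ Suc m) (f \<mu>))"
      using addn[of m "f \<mu> - (a + \<mu> *\<^sub>C P (f \<mu>))" "a + \<mu> *\<^sub>C P (f \<mu>)"]
      by (simp add: addn scalen funpow_Suc_right algebra_simps del: funpow.simps)
    ultimately have "(f \<mu> - ((\<Sum>j<m. \<mu> ^ j *\<^sub>C (P ^^ j) a) + \<mu> ^ m *\<^sub>C (P ^^ m) (f \<mu>)))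
       + \<mu> ^ m *\<^sub>C ((P ^^ m) (f \<mu>) - ((P ^^ m) a + \<mu> *\<^sub>C (P ^^ Suc m) (f \<mu>))) \<in> H"
      using closed_csubspaceD(3)[OF H Suc.IH] by (simp del: funpow.simps)
    moreover have "\<mu> ^ m *\<^sub>C \<mu> *\<^sub>C (P ^^ Suc m) (f \<mu>) = \<mu> ^ Suc m *\<^sub>C (P ^^ Suc m) (f \<mu>)"
      by (simp only: scaleC_scaleC power_Suc2)
    ultimately show ?case
      by (simp add: scaleC_diff_right scaleC_add_right algebra_simps del: funpow.simps power_Suc)
  qed
  have "circle_average n r (\<lambda>\<mu>. f \<mu> - (\<Sum>j<n. \<mu> ^ j *\<^sub>C (P ^^ j) a) - of_real (r ^ n) *\<^sub>C (P ^^ n) (f \<mu>)) \<in> H"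
    unfolding circle_average_def
  proof (intro closed_csubspaceD(4)[OF H] subspace_sum[OF closed_csubspace_subspace[OF H]])
    fix k
    define \<mu> where "\<mu> = of_real r * unity_root n k"
    have "\<mu> ^ n = of_real (r ^ n)" unfolding \<mu>_def power_mult_distrib using n by (simp add: unity_root_power_n)
    moreover have "cmod \<mu> = r" using r by (simp add: \<mu>_def norm_mult)
    ultimately show "f \<mu> - (\<Sum>j<n. \<mu> ^ j *\<^sub>C (P ^^ j) a) - of_real (r ^ n) *\<^sub>C (P ^^ n) (f \<mu>) \<in> H"
      using expand[of \<mu> n] by (simp add: algebra_simps)
  qed
  moreover have "circle_average n r (\<lambda>\<mu>. of_real (r ^ n) *\<^sub>C (P ^^ n) (f \<mu>)) = of_real (r ^ n) *\<^sub>C (P ^^ n) (circle_average n r f)"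
    by (rule circle_average_linear[symmetric]) (simp_all add: addn scalen scaleC_add_right scaleC_scaleC mult.commute)
  ultimately show ?thesis
    unfolding circle_average_diff circle_average_polynomial[OF n] by (simp add: algebra_simps)
qed

text \<open>
  The points of the average of order \<open>n * m\<close> split into \<open>n\<close> arcs of \<open>m\<close> points, each close to one
  point of the average of order \<open>n\<close>. Two averages can therefore be compared through a common
  refinement, which makes the averages of a uniformly continuous function a Cauchy sequence.
\<close>

lemma circle_average_refine:
  assumes H: "closed_csubspace H" and r: "r \<ge> 0" and n: "n > 0" and m: "m > 0"
    and step: "2 * pi * r / real n < d"
    and f: "\<And>\<mu> \<nu>. cmod \<mu> = r \<Longrightarrow> cmod \<nu> = r \<Longrightarrow> cmod (\<mu> - \<nu>) < d \<Longrightarrow> infdist (f \<mu> - f \<nu>) H \<le> e"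
  shows "infdist (circle_average n r f - circle_average (n * m) r f) H \<le> e"
proof -
  let ?z = "\<lambda>n k. of_real r * unity_root n k"
  have "circle_average n r f = (1 / of_nat (n * m)) *\<^sub>C (\<Sum>i<n. of_nat m *\<^sub>C f (?z n i))"
    using n m by (simp add: circle_average_def scaleC_sum_right scaleC_scaleC)
  also have "\<dots> = (1 / of_nat (n * m)) *\<^sub>C (\<Sum>i<n. \<Sum>k\<in>{i*m..<i*m+m}. f (?z n i))"
  proof -
    have "(\<Sum>k\<in>{i*m..<i*m+m}. x) = of_nat m *\<^sub>C x" for i and x :: 'a
      using scaleC_sum_left[of "\<lambda>_. 1" "{i*m..<i*m+m}" x] by simp
    then show ?thesis by simp
  qed
  finally have 1: "circle_average n r f = \<dots>" .
  have "circle_average (n * m) r f = (1 / of_nat (n * m)) *\<^sub>C (\<Sum>i<n. \<Sum>k\<in>{i*m..<i*m+m}. f (?z (n * m) k))"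
    unfolding circle_average_def sum.nat_group ..
  with 1 have "circle_average n r f - circle_average (n * m) r f
    = (1 / of_nat (n * m)) *\<^sub>C (\<Sum>i<n. \<Sum>k\<in>{i*m..<i*m+m}. f (?z n i) - f (?z (n * m) k))"
    by (simp add: sum_subtractf scaleC_diff_right)
  then have "infdist (circle_average n r f - circle_average (n * m) r f) H
    = (1 / real (n * m)) * infdist (\<Sum>i<n. \<Sum>k\<in>{i*m..<i*m+m}. f (?z n i) - f (?z (n * m) k)) H"
    by (simp add: quotient_norm_scaleC[OF H] norm_divide norm_mult)
  also have "\<dots> \<le> (1 / real (n * m)) * (\<Sum>i<n. \<Sum>k\<in>{i*m..<i*m+m}. infdist (f (?z n i) - f (?z (n * m) k)) H)"
    by (intro mult_left_mono order_trans[OF quotient_norm_sum[OF H]] sum_mono quotient_norm_sum[OF H]) simp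
  also have "\<dots> \<le> (1 / real (n * m)) * (\<Sum>i<n. \<Sum>k\<in>{i*m..<i*m+m}. e)"
  proof (intro mult_left_mono sum_mono f)
    fix i k assume ik: "i \<in> {..<n}" "k \<in> {i*m..<i*m+m}"
    have "?z n i - ?z (n * m) k = of_real r * (unity_root n i - unity_root (n * m) k)" by (simp add: algebra_simps)
    then have "cmod (?z n i - ?z (n * m) k) = r * cmod (unity_root n i - unity_root (n * m) k)"
      using r by (simp add: norm_mult)
    also have "\<dots> \<le> r * \<bar>2 * pi * real i / real n - 2 * pi * real k / real (n * m)\<bar>"
      unfolding unity_root_def using r by (intro mult_left_mono cmod_cis_diff_le) auto
    also have "2 * pi * real i / real n - 2 * pi * real k / real (n * m) = 2 * pi / (real n * real m) * (real i * real m - real k)"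
      using n m by (simp add: field_simps)
    also have "r * \<bar>\<dots>\<bar> \<le> r * (2 * pi / (real n * real m) * real m)"
    proof -
      have "real (i * m) \<le> real k" "real k \<le> real (i * m + m)" using ik by (auto simp del: of_nat_mult of_nat_add)
      then have "\<bar>real i * real m - real k\<bar> \<le> real m" by simp
      then show ?thesis unfolding abs_mult using r by (intro mult_left_mono mult_mono) auto
    qed
    also have "\<dots> = 2 * pi * r / real n" using m by simp
    finally show "cmod (?z n i - ?z (n * m) k) < d" using step by simp
  qed (use r in \<open>auto simp: norm_mult\<close>)
  also have "\<dots> = e" using n m by simp
  finally show ?thesis .
qed

section \<open>Circle averages of a resolvent\<close>

text \<open>
  The scalar contour integral: the mean of \<open>\<xi> / (t - \<mu>)\<close> over a circle is \<open>\<xi> / t\<close> if \<open>t\<close> lies outside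
  the circle, where the recursion for resolvents leaves the remainder \<open>(r / t) ^ n\<close>, and \<open>0\<close> if
  \<open>t\<close> is its centre, where the inverses of the roots of unity cancel.
\<close>

lemma circle_average_inverse_limit:
  fixes g :: "complex \<Rightarrow> complex"
  assumes r: "r > 0" and g: "\<And>\<mu>. cmod \<mu> = r \<Longrightarrow> (t - \<mu>) * g \<mu> = \<xi>"
    and t: "t = 0 \<or> r < cmod t"
  shows "(\<lambda>n. circle_average n r g) \<longlonglongrightarrow> (if t = 0 then 0 else \<xi> / t)"
proof (cases "t = 0")
  case True
  have "circle_average n r g = 0" if n: "n \<ge> 2" for n
  proof -
    have "g (of_real r * unity_root n k) = (- \<xi> / of_real r) * unity_root n k ^ (n - 1)" for k
    proof -
      have "unity_root n k * unity_root n k ^ (n - 1) = 1"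
        using unity_root_power_n[of n k] n by (simp flip: power_Suc)
      moreover have "(0 - of_real r * unity_root n k) * g (of_real r * unity_root n k) = \<xi>"
        using g[of "of_real r * unity_root n k"] r True by (simp add: norm_mult)
      ultimately have "of_real r * g (of_real r * unity_root n k) = - \<xi> * unity_root n k ^ (n - 1)"
        by (smt (verit) diff_0 minus_mult_left minus_mult_right minus_minus mult.assoc mult.commute mult.right_neutral)
      then show ?thesis using r by (simp add: field_simps)
    qed
    then have "(\<Sum>k<n. g (of_real r * unity_root n k)) = (- \<xi> / of_real r) * (\<Sum>k<n. unity_root n k ^ (n - 1))"
      by (simp add: sum_distrib_left)
    then show ?thesis unfolding circle_average_def using sum_unity_root_power[of "n - 1" n] n by simp
  qed
  then show ?thesis using True by (auto intro!: tendsto_eventually eventually_sequentiallyI[of 2])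
next
  case False
  with t have rt: "r < cmod t" by simp
  have av: "circle_average n r g = (\<xi> / t) / (1 - (of_real r / t) ^ n)" if n: "n > 0" for n
  proof -
    have "((*) (1 / t) ^^ n) z = (1 / t) ^ n * z" for z by (induction n) simp_all
    moreover have "circle_average n r g - (\<xi> / t + of_real (r ^ n) *\<^sub>C ((*) (1 / t) ^^ n) (circle_average n r g)) \<in> {0}"
    proof (rule circle_average_resolvent[OF closed_csubspace_zero _ n])
      fix \<mu> assume \<mu>: "cmod \<mu> = r"
      show "g \<mu> - (\<xi> / t + \<mu> *\<^sub>C (1 / t * g \<mu>)) \<in> {0}"
        using g[OF \<mu>] False by (simp add: scaleC_complex_def field_simps)
    qed (use r in \<open>auto simp: scaleC_complex_def algebra_simps add_divide_distrib\<close>)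
    ultimately have "circle_average n r g * (1 - (of_real r / t) ^ n) = \<xi> / t"
      by (simp add: scaleC_complex_def algebra_simps power_divide)
    moreover have "(of_real r / t) ^ n \<noteq> 1"
    proof
      assume "(of_real r / t) ^ n = 1"
      then have "(r / cmod t) ^ n = 1" using r by (metis norm_divide norm_of_real norm_one norm_power abs_of_pos)
      moreover have "(r / cmod t) ^ n < 1"
      proof -
        have "(r / cmod t) ^ Suc (n - 1) < 1" by (rule power_Suc_less_one) (use rt r False in \<open>simp_all add: field_simps\<close>)
        then show ?thesis using n by simp
      qed
      ultimately show False by simp
    qed
    ultimately show ?thesis by (subst nonzero_eq_divide_eq) auto
  qed
  have "(\<lambda>n. (of_real r / t) ^ n) \<longlonglongrightarrow> 0"
  proof (rule LIMSEQ_power_zero)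
    have "cmod (of_real r / t) = r / cmod t" using r by (simp add: norm_divide)
    also have "\<dots> < 1" using rt r by (subst divide_less_eq_1_pos) linarith+
    finally show "cmod (of_real r / t) < 1" .
  qed
  then have "(\<lambda>n. (\<xi> / t) / (1 - (of_real r / t) ^ n)) \<longlonglongrightarrow> (\<xi> / t) / (1 - 0)"
    by (intro tendsto_divide tendsto_diff tendsto_const) auto
  then have "(\<lambda>n. circle_average n r g) \<longlonglongrightarrow> (\<xi> / t) / (1 - 0)"
    by (rule Lim_transform_eventually) (auto intro!: eventually_sequentiallyI[of 1] simp: av)
  then show ?thesis using False by simp
qed

text \<open>
  A substitute for the contour integral of the resolvent. The operators \<open>S\<close> invert \<open>T - \<mu>\<close> modulo \<open>H\<close>
  on a circle, and \<open>b\<close> represents the mean of the values \<open>S x\<close> modulo \<open>H\<close>. Every functional \<open>\<psi>\<close>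
  that is an eigenvector of the adjoint of \<open>T\<close> and vanishes on \<open>H\<close> sees only the scalar mean. The
  case \<open>H = {0}\<close> yields the generalized inverse of an operator, and the kernel of a set of
  characters as \<open>H\<close> yields units modulo that kernel.
\<close>

lemma resolvent_average:
  fixes T :: "'a::complex_banach \<Rightarrow> 'a"
  assumes H: "closed_csubspace H" and r: "r > 0" and T: "linear T"
    and S: "\<And>\<mu>. cmod \<mu> = r \<Longrightarrow> \<exists>S. bounded_clinear S \<and> S ` H \<subseteq> H \<and>
      (\<forall>y. T (S y) - \<mu> *\<^sub>C S y - y \<in> H) \<and> (\<forall>y. S (T y - \<mu> *\<^sub>C y) - y \<in> H)"
  obtains b where "\<And>\<psi> t. \<lbrakk>\<And>y z. \<psi> (y + z) = \<psi> y + \<psi> z; \<And>c y. \<psi> (c *\<^sub>C y) = c * \<psi> y;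
      \<And>y. cmod (\<psi> y) \<le> norm y; \<And>h. h \<in> H \<Longrightarrow> \<psi> h = 0; \<And>y. \<psi> (T y) = t * \<psi> y;
      t = 0 \<or> r < cmod t\<rbrakk> \<Longrightarrow> \<psi> b = (if t = 0 then 0 else \<psi> x / t)"
proof -
  obtain S where S: "\<And>\<mu>. cmod \<mu> = r \<Longrightarrow> bounded_clinear (S \<mu>)" "\<And>\<mu>. cmod \<mu> = r \<Longrightarrow> S \<mu> ` H \<subseteq> H"
    "\<And>\<mu> y. cmod \<mu> = r \<Longrightarrow> T (S \<mu> y) - \<mu> *\<^sub>C S \<mu> y - y \<in> H"
    "\<And>\<mu> y. cmod \<mu> = r \<Longrightarrow> S \<mu> (T y - \<mu> *\<^sub>C y) - y \<in> H"
    using S by metis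
  define f where "f \<mu> = S \<mu> x" for \<mu>
  let ?q = "\<lambda>y. infdist y H"
  \<comment> \<open>The resolvent identity modulo \<open>H\<close>.\<close>
  have resolvent: "?q (f \<mu> - f \<nu>) \<le> cmod (\<mu> - \<nu>) * onorm (S \<nu>) * ?q (f \<mu>)"
    if \<mu>: "cmod \<mu> = r" and \<nu>: "cmod \<nu> = r" for \<mu> \<nu>
  proof -
    have bl: "bounded_linear (S \<nu>)" and cs: "\<And>c y. S \<nu> (c *\<^sub>C y) = c *\<^sub>C S \<nu> y"
      using S(1)[OF \<nu>] unfolding bounded_clinear_def by auto
    interpret S\<nu>: bounded_linear "S \<nu>" by fact
    define h where "h = (T (f \<mu>) - \<mu> *\<^sub>C f \<mu> - x) - (T (f \<nu>) - \<nu> *\<^sub>C f \<nu> - x)"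
    have "h \<in> H" unfolding h_def f_def by (rule closed_csubspaceD(5)[OF H S(3)[OF \<mu>] S(3)[OF \<nu>]])
    then have Sh: "S \<nu> h \<in> H" using S(2)[OF \<nu>] by auto
    have "T (f \<mu> - f \<nu>) - \<nu> *\<^sub>C (f \<mu> - f \<nu>) = h + (\<mu> - \<nu>) *\<^sub>C f \<mu>"
      unfolding h_def by (simp add: linear_diff[OF T] scaleC_diff_left scaleC_diff_right)
    then have "S \<nu> h + (\<mu> - \<nu>) *\<^sub>C S \<nu> (f \<mu>) - (f \<mu> - f \<nu>) \<in> H"
      using S(4)[OF \<nu>, of "f \<mu> - f \<nu>"] by (simp add: S\<nu>.add cs)
    then have "(\<mu> - \<nu>) *\<^sub>C S \<nu> (f \<mu>) - (f \<mu> - f \<nu>) \<in> H"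
      using closed_csubspaceD(5)[OF H _ Sh] by (metis add_diff_cancel_left' add_diff_eq)
    then have "?q (f \<mu> - f \<nu>) = ?q ((\<mu> - \<nu>) *\<^sub>C S \<nu> (f \<mu>))"
      using quotient_norm_cong[OF H] by metis
    also have "\<dots> = cmod (\<mu> - \<nu>) * ?q (S \<nu> (f \<mu>))" by (rule quotient_norm_scaleC[OF H])
    also have "\<dots> \<le> cmod (\<mu> - \<nu>) * (onorm (S \<nu>) * ?q (f \<mu>))"
      using quotient_norm_bounded_linear[OF bl S(2)[OF \<nu>] H] by (intro mult_left_mono) auto
    finally show ?thesis by (simp add: mult.assoc)
  qed
  have cont: "\<exists>d>0. \<forall>\<mu>. cmod \<mu> = r \<longrightarrow> cmod (\<mu> - \<nu>) < d \<longrightarrow> ?q (f \<mu> - f \<nu>) \<le> e"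
    if \<nu>: "cmod \<nu> = r" and e: "e > 0" for \<nu> e
  proof -
    define K where "K = onorm (S \<nu>) + 1"
    have K: "K > 0" "onorm (S \<nu>) \<le> K"
      using onorm_pos_le[of "S \<nu>"] S(1)[OF \<nu>] unfolding K_def bounded_clinear_def by auto
    define d where "d = min (1 / (2 * K)) (e / (2 * K * (?q (f \<nu>) + 1)))"
    have q0: "?q y \<ge> 0" for y by (rule infdist_nonneg)
    have "d > 0" unfolding d_def using K e q0[of "f \<nu>"] by (auto simp: field_simps add_pos_nonneg)
    moreover have "?q (f \<mu> - f \<nu>) \<le> e" if \<mu>: "cmod \<mu> = r" and less: "cmod (\<mu> - \<nu>) < d" for \<mu>
    proof -
      let ?s = "cmod (\<mu> - \<nu>) * K"
      have s1: "?s \<le> 1 / 2" using less K unfolding d_def by (simp add: field_simps)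
      have s2: "2 * ?s * (?q (f \<nu>) + 1) \<le> e"
        using less K q0[of "f \<nu>"] unfolding d_def by (simp add: field_simps add_pos_nonneg)
      have "?q (f \<mu> - f \<nu>) \<le> ?s * ?q (f \<mu>)"
        using resolvent[OF \<mu> \<nu>] K q0[of "f \<mu>"] by (meson mult_left_mono mult_right_mono norm_ge_zero order_trans)
      also have "?q (f \<mu>) \<le> ?q (f \<mu> - f \<nu>) + ?q (f \<nu>)" using quotient_norm_add[OF H, of "f \<mu> - f \<nu>" "f \<nu>"] by simp
      then have "?s * ?q (f \<mu>) \<le> ?s * ?q (f \<mu> - f \<nu>) + ?s * ?q (f \<nu>)"
        using K by (simp add: mult_left_mono flip: distrib_left)
      also have "?s * ?q (f \<mu> - f \<nu>) \<le> 1/2 * ?q (f \<mu> - f \<nu>)" using s1 q0 by (intro mult_right_mono)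
      finally have "?q (f \<mu> - f \<nu>) \<le> 2 * ?s * ?q (f \<nu>)" by simp
      also have "\<dots> \<le> 2 * ?s * (?q (f \<nu>) + 1)" using K by (intro mult_left_mono) auto
      finally show ?thesis using s2 by simp
    qed
    ultimately show ?thesis by blast
  qed
  \<comment> \<open>Uniformity on the compact circle, by a Lebesgue number of the balls from the previous step.\<close>
  have unif: "\<exists>d>0. \<forall>\<mu> \<nu>. cmod \<mu> = r \<longrightarrow> cmod \<nu> = r \<longrightarrow> cmod (\<mu> - \<nu>) < d \<longrightarrow> ?q (f \<mu> - f \<nu>) \<le> e"
    if e: "e > 0" for e
  proof -
    obtain D where D: "\<And>\<nu>. cmod \<nu> = r \<Longrightarrow> D \<nu> > 0"
      "\<And>\<mu> \<nu>. cmod \<nu> = r \<Longrightarrow> cmod \<mu> = r \<Longrightarrow> cmod (\<mu> - \<nu>) < D \<nu> \<Longrightarrow> ?q (f \<mu> - f \<nu>) \<le> e / 2"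
      using cont[of _ "e/2"] e by (metis half_gt_zero)
    obtain d where d: "d > 0"
      "\<And>z. z \<in> sphere 0 r \<Longrightarrow> \<exists>G\<in>(\<lambda>\<nu>. ball \<nu> (D \<nu>)) ` sphere 0 r. ball z d \<subseteq> G"
    proof (rule Heine_Borel_lemma[of "sphere (0::complex) r" "(\<lambda>\<nu>. ball \<nu> (D \<nu>)) ` sphere 0 r"])
      show "sphere 0 r \<subseteq> \<Union>((\<lambda>\<nu>. ball \<nu> (D \<nu>)) ` sphere 0 r)"
        using D(1) by (auto intro!: bexI simp: centre_in_ball)
    qed auto
    have "?q (f \<mu> - f \<nu>) \<le> e" if \<mu>: "cmod \<mu> = r" and \<nu>: "cmod \<nu> = r" and less: "cmod (\<mu> - \<nu>) < d" for \<mu> \<nu>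
    proof -
      obtain \<kappa> where \<kappa>: "cmod \<kappa> = r" "ball \<mu> d \<subseteq> ball \<kappa> (D \<kappa>)" using d(2)[of \<mu>] \<mu> by auto
      have "\<mu> \<in> ball \<kappa> (D \<kappa>)" "\<nu> \<in> ball \<kappa> (D \<kappa>)" using \<kappa>(2) d(1) less by (auto simp: subset_iff dist_norm)
      then have "?q (f \<mu> - f \<kappa>) \<le> e / 2" "?q (f \<nu> - f \<kappa>) \<le> e / 2"
        using D(2)[OF \<kappa>(1)] \<mu> \<nu> by (auto simp: dist_norm norm_minus_commute)
      then show ?thesis
        using quotient_norm_triangle[OF H, of "f \<mu>" "f \<nu>" "f \<kappa>"] quotient_norm_minus_commute[OF H, of "f \<kappa>" "f \<nu>"] by simp
    qed
    then show ?thesis using d(1) by blast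
  qed
  \<comment> \<open>Shifted by one, since the average of order 0 carries no information.\<close>
  define a where "a n = circle_average (Suc n) r f" for n
  have cauchy: "\<exists>N. \<forall>m\<ge>N. \<forall>n\<ge>N. ?q (a m - a n) < e" if e: "e > 0" for e
  proof -
    obtain d where d: "d > 0" "\<And>\<mu> \<nu>. cmod \<mu> = r \<Longrightarrow> cmod \<nu> = r \<Longrightarrow> cmod (\<mu> - \<nu>) < d \<Longrightarrow> ?q (f \<mu> - f \<nu>) \<le> e / 3"
      using unif[of "e / 3"] e by auto
    obtain N where N: "real N > 2 * pi * r / d" using reals_Archimedean2 by blast
    have "?q (a m - a n) < e" if mn: "m \<ge> N" "n \<ge> N" for m n
    proof -
      have step: "2 * pi * r / real (Suc k) < d" if "k \<ge> N" for k
      proof -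
        have "2 * pi * r / d < real (Suc k)" using N that by linarith
        then show ?thesis using d(1) by (simp add: field_simps)
      qed
      have "?q (a m - circle_average (Suc m * Suc n) r f) \<le> e / 3"
        unfolding a_def using r d(2) step[OF mn(1)] by (intro circle_average_refine[OF H]) auto
      moreover have "?q (a n - circle_average (Suc n * Suc m) r f) \<le> e / 3"
        unfolding a_def using r d(2) step[OF mn(2)] by (intro circle_average_refine[OF H]) auto
      ultimately show ?thesis
        using e quotient_norm_triangle[OF H, of "a m" "a n" "circle_average (Suc m * Suc n) r f"]
          quotient_norm_minus_commute[OF H, of "circle_average (Suc m * Suc n) r f" "a n"]
        by (simp only: mult.commute[of "Suc n" "Suc m"])
    qed
    then show ?thesis by blast
  qed
  obtain b g where b: "strict_mono g" "(\<lambda>k. ?q (a (g k) - b)) \<longlonglongrightarrow> 0"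
    using quotient_norm_complete[OF H cauchy] by blast
  show ?thesis
  proof (rule that)
    fix \<psi> t
    assume add: "\<And>y z. \<psi> (y + z) = \<psi> y + \<psi> z" and scale: "\<And>c y. \<psi> (c *\<^sub>C y) = c * \<psi> y"
      and bound: "\<And>y. cmod (\<psi> y) \<le> norm y" and \<psi>H: "\<And>h. h \<in> H \<Longrightarrow> \<psi> h = 0"
      and \<psi>T: "\<And>y. \<psi> (T y) = t * \<psi> y" and t: "t = 0 \<or> r < cmod t"
    have diff: "\<psi> (y - z) = \<psi> y - \<psi> z" for y z using add[of "y - z" z] by simp
    have \<psi>q: "cmod (\<psi> y) \<le> ?q y" for y
    proof (rule field_le_epsilon)
      fix e :: real assume "e > 0"
      then obtain h where "h \<in> H" "norm (y - h) < ?q y + e"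
        using quotient_norm_approx[of H e y] closed_csubspaceD(2)[OF H] by (metis emptyE)
      then show "cmod (\<psi> y) \<le> ?q y + e" using bound[of "y - h"] \<psi>H by (simp add: diff)
    qed
    have "(\<lambda>n. circle_average n r (\<lambda>\<mu>. \<psi> (f \<mu>))) \<longlonglongrightarrow> (if t = 0 then 0 else \<psi> x / t)"
    proof (rule circle_average_inverse_limit[OF r _ t])
      fix \<mu> assume "cmod \<mu> = r"
      then have "\<psi> (T (f \<mu>) - \<mu> *\<^sub>C f \<mu> - x) = 0" unfolding f_def using S(3) \<psi>H by blast
      then show "(t - \<mu>) * \<psi> (f \<mu>) = \<psi> x" by (simp add: diff scale \<psi>T left_diff_distrib)
    qed
    moreover have "circle_average n r (\<lambda>\<mu>. \<psi> (f \<mu>)) = \<psi> (circle_average n r f)" for n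
    proof -
      have "\<psi> 0 = 0" using add[of 0 0] by simp
      then have "\<psi> (\<Sum>k\<in>A. u k) = (\<Sum>k\<in>A. \<psi> (u k))" for u and A :: "nat set"
        by (induction A rule: infinite_finite_induct) (simp_all add: add)
      then show ?thesis by (simp add: circle_average_def scale scaleC_complex_def)
    qed
    ultimately have "(\<lambda>n. \<psi> (a n)) \<longlonglongrightarrow> (if t = 0 then 0 else \<psi> x / t)"
      unfolding a_def using LIMSEQ_Suc[of "\<lambda>n. \<psi> (circle_average n r f)"] by simp
    then have "(\<lambda>k. \<psi> (a (g k))) \<longlonglongrightarrow> (if t = 0 then 0 else \<psi> x / t)"
      using LIMSEQ_subseq_LIMSEQ[OF _ b(1)] by (auto simp: o_def)
    moreover have "(\<lambda>k. \<psi> (a (g k))) \<longlonglongrightarrow> \<psi> b"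
    proof (rule LIM_zero_cancel)
      show "(\<lambda>k. \<psi> (a (g k)) - \<psi> b) \<longlonglongrightarrow> 0"
        by (rule Lim_null_comparison[OF _ b(2)]) (use \<psi>q in \<open>simp flip: diff\<close>)
    qed
    ultimately show "\<psi> b = (if t = 0 then 0 else \<psi> x / t)" by (rule LIMSEQ_unique[rotated])
  qed
qed


section \<open>Characters and modular ideals\<close>

lemma characterD:
  assumes "\<phi> \<in> gelfand_space"
  shows "\<phi> (x + y) = \<phi> x + \<phi> y" "\<phi> (c *\<^sub>C x) = c * \<phi> x" "\<phi> (x * y) = \<phi> x * \<phi> y"
    "\<phi> 0 = 0" "\<phi> (x - y) = \<phi> x - \<phi> y"
proof -
  show add: "\<phi> (x + y) = \<phi> x + \<phi> y" for x y using assms unfolding gelfand_space_def by blast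
  show "\<phi> (c *\<^sub>C x) = c * \<phi> x" "\<phi> (x * y) = \<phi> x * \<phi> y" using assms unfolding gelfand_space_def by blast+
  show "\<phi> 0 = 0" using add[of 0 0] by simp
  show "\<phi> (x - y) = \<phi> x - \<phi> y" using add[of "x - y" y] by simp
qed

lemma character_nonzero:
  assumes "\<phi> \<in> gelfand_space"
  obtains w where "\<phi> w = 1"
proof -
  obtain x where "\<phi> x \<noteq> 0" using assms unfolding gelfand_space_def by blast
  then have "\<phi> ((1 / \<phi> x) *\<^sub>C x) = 1" by (simp add: characterD[OF assms])
  then show ?thesis using that by blast
qed

text \<open>
  The Neumann series \<open>z + z\<^sup>2 + z\<^sup>3 + \<dots>\<close>, obtained as a fixed point because there is no unit with
  which to write powers.
\<close>

lemma quasi_inverse_exists: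
  fixes z :: "'a::comm_complex_banach_algebra"
  assumes "norm z < 1"
  obtains y where "y = z + z * y"
proof -
  have "\<exists>!y. z + z * y = y"
  proof (rule banach_fix_type[of "norm z"])
    show "\<forall>x y. dist (z + z * x) (z + z * y) \<le> norm z * dist x y"
      by (auto simp: dist_norm norm_mult_ineq simp flip: right_diff_distrib)
  qed (use assms in auto)
  then show ?thesis using that by metis
qed

text \<open>
  Automatic continuity: if \<open>\<phi> z = 1\<close> and \<open>norm z < 1\<close>, a quasi-inverse \<open>y\<close> of \<open>z\<close> would satisfy
  \<open>\<phi> y = 1 + \<phi> y\<close>.
\<close>

lemma character_norm_le:
  assumes \<phi>: "\<phi> \<in> gelfand_space"
  shows "cmod (\<phi> x) \<le> norm x"
proof (rule ccontr)
  assume less: "\<not> cmod (\<phi> x) \<le> norm x"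
  then have nz: "\<phi> x \<noteq> 0" by auto
  define z where "z = (1 / \<phi> x) *\<^sub>C x"
  have z: "\<phi> z = 1" using nz by (simp add: z_def characterD[OF \<phi>])
  have "norm z < 1" unfolding z_def using less nz by (simp add: norm_scaleC norm_divide field_simps)
  then obtain y where "y = z + z * y" by (rule quasi_inverse_exists)
  then have "\<phi> y = \<phi> z + \<phi> z * \<phi> y" by (metis characterD(1,3)[OF \<phi>])
  then show False using z by simp
qed

definition algebra_ideal :: "'a::comm_complex_banach_algebra set \<Rightarrow> bool" where
  "algebra_ideal I \<longleftrightarrow> 0 \<in> I \<and> (\<forall>x\<in>I. \<forall>y\<in>I. x + y \<in> I) \<and> (\<forall>c. \<forall>x\<in>I. c *\<^sub>C x \<in> I) \<and> (\<forall>x\<in>I. \<forall>y. x * y \<in> I)"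

lemma algebra_idealD:
  assumes "algebra_ideal I"
  shows "0 \<in> I" "x \<in> I \<Longrightarrow> y \<in> I \<Longrightarrow> x + y \<in> I" "x \<in> I \<Longrightarrow> c *\<^sub>C x \<in> I"
    "x \<in> I \<Longrightarrow> x * y \<in> I" "x \<in> I \<Longrightarrow> y * x \<in> I" "x \<in> I \<Longrightarrow> - x \<in> I" "x \<in> I \<Longrightarrow> y \<in> I \<Longrightarrow> x - y \<in> I"
proof -
  show add: "x \<in> I \<Longrightarrow> y \<in> I \<Longrightarrow> x + y \<in> I" and sc: "x \<in> I \<Longrightarrow> c *\<^sub>C x \<in> I" for c x y
    using assms unfolding algebra_ideal_def by blast+
  show "0 \<in> I" "x \<in> I \<Longrightarrow> x * y \<in> I" "x \<in> I \<Longrightarrow> y * x \<in> I"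
    using assms unfolding algebra_ideal_def by (auto simp: mult.commute[of y x])
  show neg: "x \<in> I \<Longrightarrow> - x \<in> I" for x using sc[of x "-1"] by (simp add: scaleC_minus_left)
  show "x \<in> I \<Longrightarrow> y \<in> I \<Longrightarrow> x - y \<in> I" using add[of x "- y"] neg[of y] by simp
qed

text \<open>
  The ideals that prove solvability of \<open>P v = u\<close> modulo \<open>I\<close>: if \<open>u\<close> is a unit modulo this ideal and no
  character vanishes on the ideal, then \<open>u\<close> belongs to it.
\<close>

lemma algebra_ideal_range_plus:
  fixes P :: "'a::comm_complex_banach_algebra \<Rightarrow> 'a"
  assumes add: "\<And>x y. P (x + y) = P x + P y" and scale: "\<And>c x. P (c *\<^sub>C x) = c *\<^sub>C P x"
    and mult: "\<And>x y. P x * y = P (x * y)" and I: "algebra_ideal I"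
  shows "algebra_ideal {P v + h | v h. h \<in> I}" (is "algebra_ideal ?J")
    and "P v \<in> {P v + h | v h. h \<in> I}"
    and "h \<in> I \<Longrightarrow> h \<in> {P v + h | v h. h \<in> I}"
proof -
  note memI = algebra_idealD[OF I]
  have P0: "P 0 = 0" using add[of 0 0] by simp
  have J: "P v + h \<in> ?J" if "h \<in> I" for v h using that by blast
  show PJ: "P v \<in> ?J" for v using J[OF memI(1), of v] by simp
  show "h \<in> I \<Longrightarrow> h \<in> ?J" using J[of h 0] P0 by simp
  show "algebra_ideal ?J"
    unfolding algebra_ideal_def
  proof (intro conjI ballI allI)
    show "0 \<in> ?J" using PJ[of 0] P0 by simp
    fix p assume "p \<in> ?J"
    then obtain v h where p: "p = P v + h" "h \<in> I" by blast
    show "p + q \<in> ?J" if "q \<in> ?J" for q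
    proof -
      obtain v' h' where q: "q = P v' + h'" "h' \<in> I" using \<open>q \<in> ?J\<close> by blast
      have "p + q = P (v + v') + (h + h')" unfolding p q add by simp
      then show ?thesis using J[OF memI(2)[OF p(2) q(2)]] by simp
    qed
    show "c *\<^sub>C p \<in> ?J" for c
      unfolding p scaleC_add_right using J[OF memI(3)[OF p(2)]] by (simp add: scale[symmetric])
    show "p * q \<in> ?J" for q
      unfolding p distrib_right mult by (rule J[OF memI(4)[OF p(2)]])
  qed
qed

lemma algebra_ideal_closed_csubspace: "algebra_ideal I \<Longrightarrow> closed I \<Longrightarrow> closed_csubspace I"
  unfolding algebra_ideal_def closed_csubspace_def by blast

lemma quotient_norm_mult:
  assumes I: "algebra_ideal I" "closed I"
  shows "infdist (x * y) I \<le> infdist x I * infdist y I"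
proof -
  have cs: "closed_csubspace I" using I by (rule algebra_ideal_closed_csubspace)
  have ne: "I \<noteq> {}" using algebra_idealD(1)[OF I(1)] by auto
  have q0: "infdist z I \<ge> 0" for z by (rule infdist_nonneg)
  have le: "infdist (x * y) I \<le> (infdist x I + e) * (infdist y I + e)" if e: "e > 0" for e
  proof -
    obtain h where h: "h \<in> I" "norm (x - h) < infdist x I + e" using quotient_norm_approx[OF ne e] by blast
    obtain k where k: "k \<in> I" "norm (y - k) < infdist y I + e" using quotient_norm_approx[OF ne e] by blast
    have "x * y - (x - h) * (y - k) = h * (y - k) + x * k" by (simp add: algebra_simps)
    also have "\<dots> \<in> I" using h k I by (auto intro: algebra_idealD)
    finally have "infdist (x * y) I = infdist ((x - h) * (y - k)) I" using quotient_norm_cong[OF cs] by blast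
    also have "\<dots> \<le> norm ((x - h) * (y - k))" by (rule quotient_norm_le_norm[OF cs])
    also have "\<dots> \<le> norm (x - h) * norm (y - k)" by (rule norm_mult_ineq)
    also have "\<dots> \<le> (infdist x I + e) * (infdist y I + e)"
      using h k q0 e by (intro mult_mono) (auto intro: less_imp_le add_nonneg_nonneg)
    finally show ?thesis .
  qed
  have "((\<lambda>e. (infdist x I + e) * (infdist y I + e)) \<longlongrightarrow> (infdist x I + 0) * (infdist y I + 0)) (at_right 0)"
    by (intro tendsto_intros)
  then have "infdist (x * y) I \<le> (infdist x I + 0) * (infdist y I + 0)"
    by (rule tendsto_lowerbound) (auto simp: eventually_at_right_field le intro: exI[of _ 1])
  then show ?thesis by simp
qed

text \<open>
  Spectra in the quotient by \<open>I\<close>, whose unit is represented by \<open>u\<close>, are non-empty. If \<open>x - \<mu> u\<close> had an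
  inverse \<open>f \<mu>\<close> for every \<open>\<mu>\<close>, the quotient norm of \<open>f \<mu>\<close> would be continuous and tend to \<open>0\<close> at
  infinity, so it would attain a maximum \<open>m > 0\<close>. The maximum spreads: at a maximum point \<open>\<nu>\<close> the
  norm of \<open>f \<nu>\<close> is at most \<open>1 + 1 / 2\<^sup>n\<close> times that of the average of \<open>n\<close> values on the circle of
  radius \<open>1 / (2 m)\<close> around \<open>\<nu>\<close>. A value of norm \<open>m - \<delta>\<close> among them lowers the average by \<open>\<delta> / n\<close>,
  which for large \<open>n\<close> is more than the factor can make up for.
  Since the radius does not depend on \<open>\<nu>\<close>, walking in one direction contradicts the decay.
\<close>

lemma modular_gelfand_mazur:
  fixes I :: "'a::comm_complex_banach_algebra set"
  assumes I: "algebra_ideal I" "closed I" and unit: "\<And>y. u * y - y \<in> I" and u: "u \<notin> I"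
  obtains \<mu> where "\<And>y. (x - \<mu> *\<^sub>C u) * y - u \<notin> I"
proof (rule ccontr)
  assume "\<not> thesis"
  with that have "\<exists>y. (x - \<mu> *\<^sub>C u) * y - u \<in> I" for \<mu> by blast
  then obtain f where f: "\<And>\<mu>. (x - \<mu> *\<^sub>C u) * f \<mu> - u \<in> I" by metis
  have cs: "closed_csubspace I" using I by (rule algebra_ideal_closed_csubspace)
  note memI = algebra_idealD[OF I(1)]
  let ?q = "\<lambda>y. infdist y I"
  have qpos: "y \<notin> I \<Longrightarrow> ?q y > 0" for y using quotient_norm_eq_0[OF cs] infdist_nonneg[of y I] by fastforce
  have fI: "f \<mu> \<notin> I" for \<mu>
  proof
    assume "f \<mu> \<in> I"
    then have "(x - \<mu> *\<^sub>C u) * f \<mu> - ((x - \<mu> *\<^sub>C u) * f \<mu> - u) \<in> I" by (intro memI(7) memI(5) f)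
    then show False using u by simp
  qed
  have resolvent: "f \<mu> - (f \<nu> + (\<mu> - \<nu>) *\<^sub>C (f \<nu> * f \<mu>)) \<in> I" for \<mu> \<nu>
  proof -
    define A where "A = (x - \<nu> *\<^sub>C u) * f \<nu> - u"
    define B where "B = (x - \<mu> *\<^sub>C u) * f \<mu> - u"
    define C where "C y = u * y - y" for y
    have mem: "A \<in> I" "B \<in> I" "C y \<in> I" for y unfolding A_def B_def C_def using f unit by auto
    have "f \<mu> - (f \<nu> + (\<mu> - \<nu>) *\<^sub>C (f \<nu> * f \<mu>)) = f \<nu> * B - f \<mu> * A - C (f \<mu>) + C (f \<nu>)
        + (\<mu> - \<nu>) *\<^sub>C C (f \<nu> * f \<mu>)"
      unfolding A_def B_def C_def
      by (simp add: algebra_simps scaleC_diff_left scaleC_diff_right mult_scaleC_left mult_scaleC_right)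
    also have "\<dots> \<in> I" using mem by (intro memI(2) memI(3) memI(5) memI(7))
    finally show ?thesis .
  qed
  have qdiff: "?q (f \<mu>) \<le> ?q (f \<nu>) + cmod (\<mu> - \<nu>) * ?q (f \<nu>) * ?q (f \<mu>)" for \<mu> \<nu>
  proof -
    have "?q (f \<mu>) = ?q (f \<nu> + (\<mu> - \<nu>) *\<^sub>C (f \<nu> * f \<mu>))" by (rule quotient_norm_cong[OF cs resolvent])
    also have "\<dots> \<le> ?q (f \<nu>) + cmod (\<mu> - \<nu>) * ?q (f \<nu> * f \<mu>)"
      using quotient_norm_add[OF cs] by (metis quotient_norm_scaleC[OF cs])
    also have "\<dots> \<le> ?q (f \<nu>) + cmod (\<mu> - \<nu>) * (?q (f \<nu>) * ?q (f \<mu>))"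
      using quotient_norm_mult[OF I] by (intro add_left_mono mult_left_mono) auto
    finally show ?thesis by (simp add: mult.assoc)
  qed
  \<comment> \<open>The reciprocal is 1-Lipschitz by the resolvent identity, and large at infinity.\<close>
  define d where "d \<mu> = 1 / ?q (f \<mu>)" for \<mu>
  have dpos: "d \<mu> > 0" for \<mu> unfolding d_def using qpos[OF fI] by simp
  have dle: "d \<nu> \<le> d \<mu> + cmod (\<mu> - \<nu>)" for \<mu> \<nu>
  proof -
    have "?q (f \<mu>) / (?q (f \<nu>) * ?q (f \<mu>)) \<le> (?q (f \<nu>) + cmod (\<mu> - \<nu>) * ?q (f \<nu>) * ?q (f \<mu>)) / (?q (f \<nu>) * ?q (f \<mu>))"
      using qdiff[of \<mu> \<nu>] by (intro divide_right_mono) (auto intro!: mult_nonneg_nonneg infdist_nonneg)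
    then show ?thesis unfolding d_def using qpos[OF fI, of \<mu>] qpos[OF fI, of \<nu>] by (simp add: add_divide_distrib)
  qed
  have "\<bar>d \<mu> - d \<nu>\<bar> \<le> cmod (\<mu> - \<nu>)" for \<mu> \<nu>
    using dle[of \<nu> \<mu>] dle[of \<mu> \<nu>] by (simp add: norm_minus_commute abs_le_iff)
  then have "1-lipschitz_on UNIV d" by (intro lipschitz_onI) (auto simp: dist_norm)
  then have dcont: "continuous_on A d" for A
    using lipschitz_on_continuous_on continuous_on_subset by blast
  have uq: "?q u > 0" using qpos[OF u] .
  have growth: "cmod \<mu> \<le> ?q x + ?q u * d \<mu>" for \<mu>
  proof -
    have "\<mu> *\<^sub>C f \<mu> - (x * f \<mu> - u) = - (\<mu> *\<^sub>C (u * f \<mu> - f \<mu>)) - ((x - \<mu> *\<^sub>C u) * f \<mu> - u)"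
      by (simp add: algebra_simps scaleC_diff_right mult_scaleC_left mult_scaleC_right)
    also have "\<dots> \<in> I" by (rule memI(7)[OF memI(6)[OF memI(3)[OF unit]] f])
    finally have "cmod \<mu> * ?q (f \<mu>) = ?q (x * f \<mu> - u)"
      using quotient_norm_cong[OF cs] quotient_norm_scaleC[OF cs] by metis
    also have "\<dots> \<le> ?q (x * f \<mu>) + ?q u"
      using quotient_norm_triangle[OF cs, of "x * f \<mu>" u 0] quotient_norm_minus_commute[OF cs, of 0 u] by simp
    also have "\<dots> \<le> ?q x * ?q (f \<mu>) + ?q u" using quotient_norm_mult[OF I] by simp
    finally show ?thesis unfolding d_def using qpos[OF fI, of \<mu>] by (simp add: field_simps)
  qed
  obtain \<mu>0 where min: "\<And>\<mu>. d \<mu>0 \<le> d \<mu>"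
  proof -
    define R where "R = ?q x + ?q u * d 0"
    have "R \<ge> 0" unfolding R_def using uq dpos[of 0] infdist_nonneg[of x I] by simp
    then obtain \<mu>0 where \<mu>0: "\<mu>0 \<in> cball 0 R" "\<And>\<mu>. \<mu> \<in> cball 0 R \<Longrightarrow> d \<mu>0 \<le> d \<mu>"
      using continuous_attains_inf[OF compact_cball _ dcont, of "0::complex" R] by auto
    have "d \<mu>0 \<le> d \<mu>" for \<mu>
    proof (cases "\<mu> \<in> cball 0 R")
      case False
      then have "R < ?q x + ?q u * d \<mu>" using growth[of \<mu>] by (simp add: dist_norm)
      then have "d 0 < d \<mu>" using uq by (simp add: R_def)
      moreover have "d \<mu>0 \<le> d 0" using \<mu>0(2)[of 0] \<open>R \<ge> 0\<close> by simp
      ultimately show ?thesis by simp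
    qed (use \<mu>0 in auto)
    then show ?thesis using that by blast
  qed
  define m where "m = ?q (f \<mu>0)"
  have m: "m > 0" unfolding m_def by (rule qpos[OF fI])
  have qm: "?q (f \<mu>) \<le> m" for \<mu>
    using min[of \<mu>] qpos[OF fI, of \<mu>] qpos[OF fI, of \<mu>0] unfolding d_def m_def by (simp add: field_simps)
  define r where "r = 1 / (2 * m)"
  have r: "r > 0" unfolding r_def using m by simp
  have step: "?q (f (\<nu> + of_real r)) = m" if \<nu>: "?q (f \<nu>) = m" for \<nu>
  proof -
    \<comment> \<open>The point \<open>k = 0\<close> of every average is \<open>r\<close> itself, so one and the same value is tested for all \<open>n\<close>.\<close>
    define g where "g \<zeta> = f (\<nu> + \<zeta>)" for \<zeta>
    define \<delta> where "\<delta> = m - ?q (g (of_real r))"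
    have \<delta>0: "\<delta> \<ge> 0" unfolding \<delta>_def g_def using qm by simp
    have bound: "\<delta> \<le> m * (real n * (1/2) ^ n)" if n: "n > 0" for n
    proof -
      define E where "E = circle_average n r g"
      define P where "P = (*) (f \<nu>)"
      have "E - (f \<nu> + of_real (r ^ n) *\<^sub>C (P ^^ n) E) \<in> I"
        unfolding E_def
      proof (rule circle_average_resolvent[OF cs _ n])
        show "g \<zeta> - (f \<nu> + \<zeta> *\<^sub>C P (g \<zeta>)) \<in> I" for \<zeta>
          using resolvent[of "\<nu> + \<zeta>" \<nu>] unfolding g_def P_def by simp
        show "P ` I \<subseteq> I" unfolding P_def using memI(5) by blast
      qed (use r in \<open>auto simp: P_def distrib_left mult_scaleC_right\<close>)
      then have "- (E - (f \<nu> + of_real (r ^ n) *\<^sub>C (P ^^ n) E)) \<in> I" by (rule memI)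
      then have "f \<nu> - (E - of_real (r ^ n) *\<^sub>C (P ^^ n) E) \<in> I" by (simp add: algebra_simps)
      then have "m = ?q (E - of_real (r ^ n) *\<^sub>C (P ^^ n) E)" using quotient_norm_cong[OF cs] \<nu> by metis
      also have "\<dots> \<le> ?q E + ?q (of_real (r ^ n) *\<^sub>C (P ^^ n) E)"
        using quotient_norm_triangle[OF cs, of E "of_real (r ^ n) *\<^sub>C (P ^^ n) E" 0]
          quotient_norm_minus_commute[OF cs, of 0 "of_real (r ^ n) *\<^sub>C (P ^^ n) E"] by simp
      also have "?q (of_real (r ^ n) *\<^sub>C (P ^^ n) E) = r ^ n * ?q ((P ^^ n) E)"
        using r by (simp add: quotient_norm_scaleC[OF cs] norm_power)
      also have "?q ((P ^^ k) E) \<le> m ^ k * ?q E" for k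
      proof (induction k)
        case (Suc k)
        have "?q ((P ^^ Suc k) E) \<le> m * ?q ((P ^^ k) E)"
          using quotient_norm_mult[OF I, of "f \<nu>" "(P ^^ k) E"] \<nu> by (simp add: P_def)
        also have "\<dots> \<le> m * (m ^ k * ?q E)" using Suc m by simp
        finally show ?case by (simp add: mult.assoc)
      qed simp
      then have "r ^ n * ?q ((P ^^ n) E) \<le> r ^ n * (m ^ n * ?q E)" using r by (intro mult_left_mono) auto
      also have "r ^ n * (m ^ n * ?q E) = (1/2) ^ n * ?q E"
        using m by (simp add: r_def field_simps)
      finally have 1: "m \<le> (1 + (1/2) ^ n) * ?q E" by (simp add: algebra_simps)
      have "real n * ?q E = ?q (\<Sum>k<n. g (of_real r * unity_root n k))"
        unfolding E_def circle_average_def quotient_norm_scaleC[OF cs] using n by (simp add: norm_divide)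
      also have "\<dots> \<le> (\<Sum>k<n. ?q (g (of_real r * unity_root n k)))" by (rule quotient_norm_sum[OF cs])
      also have "\<dots> = ?q (g (of_real r)) + (\<Sum>k\<in>{..<n} - {0}. ?q (g (of_real r * unity_root n k)))"
        using n by (subst sum.remove[of _ 0]) auto
      also have "\<dots> \<le> ?q (g (of_real r)) + (\<Sum>k\<in>{..<n} - {0}. m)"
        by (intro add_left_mono sum_mono) (simp add: g_def qm)
      also have "\<dots> = real n * m - \<delta>" using n by (simp add: \<delta>_def of_nat_diff algebra_simps)
      finally have 2: "real n * ?q E \<le> real n * m - \<delta>" .
      have "real n * m \<le> (1 + (1/2) ^ n) * (real n * ?q E)" using mult_left_mono[OF 1, of "real n"] by (simp add: algebra_simps)
      also have "\<dots> \<le> (1 + (1/2) ^ n) * (real n * m - \<delta>)" using 2 by (intro mult_left_mono) auto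
      finally have "\<delta> + (1/2) ^ n * \<delta> \<le> real n * m * (1/2) ^ n" by (simp add: algebra_simps)
      moreover have "(1/2) ^ n * \<delta> \<ge> 0" using \<delta>0 by simp
      ultimately show ?thesis by (simp add: mult_ac)
    qed
    have "(\<lambda>n. real n * (1/2) ^ n) \<longlonglongrightarrow> 0"
      using powser_times_n_limit_0[of "1/2::real"] by simp
    then have "(\<lambda>n. m * (real n * (1/2) ^ n)) \<longlonglongrightarrow> m * 0" by (intro tendsto_intros)
    then have "\<delta> \<le> m * 0" by (rule LIMSEQ_le_const) (use bound in \<open>auto intro: exI[of _ 1]\<close>)
    with \<delta>0 show ?thesis by (simp add: \<delta>_def g_def)
  qed
  have walk: "?q (f (\<mu>0 + of_real (real k * r))) = m" for k
  proof (induction k)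
    case (Suc k) then show ?case using step[of "\<mu>0 + of_real (real k * r)"] by (simp add: algebra_simps)
  qed (simp add: m_def)
  obtain k where k: "real k > (?q x + ?q u / m - Re \<mu>0) / r" using reals_Archimedean2 by blast
  have "Re \<mu>0 + real k * r \<le> cmod (\<mu>0 + of_real (real k * r))"
    using complex_Re_le_cmod[of "\<mu>0 + of_real (real k * r)"] by simp
  also have "\<dots> \<le> ?q x + ?q u / m" using growth[of "\<mu>0 + of_real (real k * r)"] by (simp add: d_def walk del: of_real_mult)
  finally show False using k r by (simp add: field_simps)
qed

text \<open>
  Zorn's lemma applies to the ideals that avoid \<open>u\<close>. A maximal one is closed because an ideal that
  comes within distance \<open>1\<close> of \<open>u\<close> contains \<open>u\<close>.
\<close>

lemma modular_maximal_ideal: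
  fixes I :: "'a::comm_complex_banach_algebra set"
  assumes I: "algebra_ideal I" and unit: "\<And>y. u * y - y \<in> I" and u: "u \<notin> I"
  obtains M where "algebra_ideal M" "closed M" "I \<subseteq> M" "u \<notin> M" "\<And>x. x \<notin> M \<Longrightarrow> \<exists>y. x * y - u \<in> M"
proof -
  define \<A> where "\<A> = {J. algebra_ideal J \<and> I \<subseteq> J \<and> u \<notin> J}"
  have "\<exists>M\<in>\<A>. \<forall>X\<in>\<A>. M \<subseteq> X \<longrightarrow> X = M"
  proof (rule subset_Zorn_nonempty)
    show "\<A> \<noteq> {}" unfolding \<A>_def using I u by blast
    fix \<C> assume ne: "\<C> \<noteq> {}" and chain: "subset.chain \<A> \<C>"
    have sub: "J \<in> \<C> \<Longrightarrow> algebra_ideal J \<and> I \<subseteq> J \<and> u \<notin> J" for J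
      using chain unfolding subset_chain_def \<A>_def by blast
    have tot: "J \<in> \<C> \<Longrightarrow> K \<in> \<C> \<Longrightarrow> J \<subseteq> K \<or> K \<subseteq> J" for J K using chain unfolding subset_chain_def by blast
    have "algebra_ideal (\<Union>\<C>)"
      unfolding algebra_ideal_def
    proof (intro conjI ballI allI)
      show "0 \<in> \<Union>\<C>" using ne sub algebra_idealD(1) by blast
      show "x + y \<in> \<Union>\<C>" if xy: "x \<in> \<Union>\<C>" "y \<in> \<Union>\<C>" for x y
      proof -
        obtain J K where JK: "x \<in> J" "J \<in> \<C>" "y \<in> K" "K \<in> \<C>" using xy by blast
        then obtain L where "L \<in> \<C>" "x \<in> L" "y \<in> L" using tot[of J K] by blast
        then show ?thesis using sub[of L] algebra_idealD(2)[of L x y] by blast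
      qed
    qed (use sub algebra_idealD(3,4) in blast)+
    moreover have "I \<subseteq> \<Union>\<C>" using ne sub by blast
    moreover have "u \<notin> \<Union>\<C>" using sub by blast
    ultimately show "\<Union>\<C> \<in> \<A>" unfolding \<A>_def by blast
  qed
  then obtain M where M: "algebra_ideal M" "I \<subseteq> M" "u \<notin> M"
    and max: "\<And>J. algebra_ideal J \<Longrightarrow> M \<subseteq> J \<Longrightarrow> u \<notin> J \<Longrightarrow> J = M"
    unfolding \<A>_def by (smt (verit, best) mem_Collect_eq subset_trans)
  note memM = algebra_idealD[OF M(1)]
  have uM: "u * y - y \<in> M" for y using unit M(2) by blast
  have "closure M = M"
  proof (rule max)
    show "M \<subseteq> closure M" by (rule closure_subset)
    show "algebra_ideal (closure M)"
      unfolding algebra_ideal_def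
    proof (intro conjI ballI allI)
      show "0 \<in> closure M" using memM(1) closure_subset by blast
      show "x + y \<in> closure M" if xy: "x \<in> closure M" "y \<in> closure M" for x y
      proof -
        obtain f g where "\<forall>n. f n \<in> M" "f \<longlonglongrightarrow> x" "\<forall>n. g n \<in> M" "g \<longlonglongrightarrow> y"
          using xy unfolding closure_sequential by blast
        then have "\<forall>n. f n + g n \<in> M" "(\<lambda>n. f n + g n) \<longlonglongrightarrow> x + y" by (auto intro: memM tendsto_add)
        then show ?thesis unfolding closure_sequential by (intro exI[of _ "\<lambda>n. f n + g n"] conjI)
      qed
      have *: "f x \<in> closure M" if "x \<in> closure M" "bounded_linear f" "f ` M \<subseteq> M" for f :: "'a \<Rightarrow> 'a" and x
        using that closure_bounded_linear_image_subset[of f M] closure_mono[of "f ` M" M] by blast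
      show "c *\<^sub>C x \<in> closure M" if "x \<in> closure M" for c x
        using that bounded_linear_scaleC by (rule *) (use memM(3) in auto)
      show "x * y \<in> closure M" if "x \<in> closure M" for x y
        using that bounded_linear_mult_left by (rule *) (use memM(4) in auto)
    qed
    show "u \<notin> closure M"
    proof
      assume "u \<in> closure M"
      then obtain i where i: "i \<in> M" "norm (u - i) < 1"
        unfolding closure_approachable by (metis dist_norm norm_minus_commute zero_less_one)
      define z where "z = u - i"
      \<comment> \<open>As \<open>z = u - i\<close> and \<open>u\<close> acts as a unit, the quasi-inverse shows \<open>z\<close>, and hence \<open>u\<close>, to lie in \<open>M\<close>.\<close>
      obtain y where y: "y = z + z * y" using quasi_inverse_exists i(2) unfolding z_def by blast
      have "i * y - (u * y - y) \<in> M" by (rule memM(7)[OF memM(4)[OF i(1)] uM])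
      moreover have "i * y - (u * y - y) = z"
      proof -
        have "i * y = u * y - z * y" unfolding z_def by (simp add: algebra_simps)
        also have "z * y = y - z" by (metis y add_diff_cancel_left')
        finally show ?thesis by simp
      qed
      ultimately have "z + i \<in> M" using memM(2)[OF _ i(1)] by simp
      then show False using M(3) by (simp add: z_def)
    qed
  qed
  then have "closed M" by (metis closed_closure)
  moreover have "\<exists>y. x * y - u \<in> M" if x: "x \<notin> M" for x
  proof -
    define J where "J = {x * a + i | a i. i \<in> M}"
    have "algebra_ideal J" and J: "x * a \<in> J" "i \<in> M \<Longrightarrow> i \<in> J" for a i
      unfolding J_def
      by (rule algebra_ideal_range_plus[where P = "(*) x"];
          simp add: M(1) distrib_left mult_scaleC_right mult.assoc)+
    moreover have "x \<in> J"
    proof -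
      have "x * u - (u * x - x) \<in> J" by (rule algebra_idealD(7)[OF \<open>algebra_ideal J\<close> J(1) J(2)[OF uM]])
      then show ?thesis by (simp add: mult.commute)
    qed
    ultimately have "u \<in> J" using max[of J] x by blast
    then obtain a i where "u = x * a + i" "i \<in> M" unfolding J_def by blast
    then have "x * a - u = - i" "- i \<in> M" by (auto simp: memM)
    then show ?thesis by metis
  qed
  ultimately show ?thesis using that M by blast
qed

text \<open>
  The quotient by a maximal modular ideal is a field, hence consists of multiples of its unit \<open>u\<close> by
  Gelfand-Mazur; the coefficient of \<open>x\<close> is the character.
\<close>

lemma modular_ideal_character:
  fixes I :: "'a::comm_complex_banach_algebra set"
  assumes I: "algebra_ideal I" and unit: "\<And>y. u * y - y \<in> I" and u: "u \<notin> I"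
  obtains \<phi> where "\<phi> \<in> gelfand_space" "\<And>x. x \<in> I \<Longrightarrow> \<phi> x = 0"
proof -
  obtain M where M: "algebra_ideal M" "closed M" "I \<subseteq> M" "u \<notin> M" "\<And>x. x \<notin> M \<Longrightarrow> \<exists>y. x * y - u \<in> M"
    using modular_maximal_ideal[OF assms] by blast
  note memM = algebra_idealD[OF M(1)]
  have uM: "u * y - y \<in> M" for y using unit M(3) by blast
  have "\<exists>\<mu>. x - \<mu> *\<^sub>C u \<in> M" for x
    using modular_gelfand_mazur[OF M(1,2) uM M(4), of x] M(5) by metis
  then obtain \<phi> where \<phi>: "\<And>x. x - \<phi> x *\<^sub>C u \<in> M" by metis
  have uniq: "\<phi> x = \<mu>" if "x - \<mu> *\<^sub>C u \<in> M" for x \<mu>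
  proof (rule ccontr)
    assume ne: "\<phi> x \<noteq> \<mu>"
    have "(x - \<mu> *\<^sub>C u) - (x - \<phi> x *\<^sub>C u) \<in> M" by (rule memM(7)[OF that \<phi>])
    then have "(1 / (\<phi> x - \<mu>)) *\<^sub>C ((\<phi> x - \<mu>) *\<^sub>C u) \<in> M" by (intro memM(3)[of "(\<phi> x - \<mu>) *\<^sub>C u"]) (simp add: scaleC_diff_left)
    then show False using M(4) ne by (simp add: scaleC_scaleC)
  qed
  have "\<phi> \<in> gelfand_space"
    unfolding gelfand_space_def
  proof (intro CollectI conjI allI)
    show "\<phi> (x + y) = \<phi> x + \<phi> y" for x y
      using memM(2)[OF \<phi>[of x] \<phi>[of y]] by (intro uniq) (simp add: scaleC_add_left algebra_simps)
    show "\<phi> (c *\<^sub>C x) = c * \<phi> x" for c x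
      using memM(3)[OF \<phi>[of x], of c] by (intro uniq) (simp add: scaleC_diff_right scaleC_scaleC)
    show "\<phi> (x * y) = \<phi> x * \<phi> y" for x y
    proof (rule uniq)
      have "x * y - (\<phi> x * \<phi> y) *\<^sub>C u = (x - \<phi> x *\<^sub>C u) * y + \<phi> x *\<^sub>C (u * y - y) + \<phi> x *\<^sub>C (y - \<phi> y *\<^sub>C u)"
        by (simp add: algebra_simps scaleC_diff_right scaleC_scaleC mult_scaleC_left mult_scaleC_right)
      also have "\<dots> \<in> M" by (rule memM(2)[OF memM(2)[OF memM(4)[OF \<phi>] memM(3)[OF uM]] memM(3)[OF \<phi>]])
      finally show "x * y - (\<phi> x * \<phi> y) *\<^sub>C u \<in> M" .
    qed
    have "\<phi> u = 1" by (rule uniq) (simp add: memM)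
    then show "\<exists>x. \<phi> x \<noteq> 0" by (intro exI[of _ u]) simp
  qed
  moreover have "\<phi> x = 0" if "x \<in> I" for x using M(3) that by (intro uniq) auto
  ultimately show ?thesis using that by blast
qed


section \<open>Multipliers of semisimple algebras\<close>

lemma semisimple_eqI:
  fixes x y :: "'a::comm_complex_banach_algebra"
  assumes "semisimple_algebra TYPE('a)" "\<And>\<phi>. \<phi> \<in> gelfand_space \<Longrightarrow> \<phi> x = \<phi> y"
  shows "x = y"
proof -
  have "\<phi> (x - y) = 0" if "\<phi> \<in> gelfand_space" for \<phi> using assms(2)[OF that] by (simp add: characterD[OF that])
  then have "x - y \<in> radical" unfolding radical_def by blast
  moreover have "(radical :: 'a set) = {0}" using assms(1) unfolding semisimple_algebra_def .
  ultimately have "x - y \<in> {0}" by (rule back_subst)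
  then show ?thesis by simp
qed

text \<open>
  The value is meaningful for multipliers \<open>T\<close> and characters \<open>\<phi>\<close>, where \<open>t\<close> is unique.
\<close>

definition multiplier_symbol :: "('a::comm_complex_banach_algebra \<Rightarrow> 'a) \<Rightarrow> ('a \<Rightarrow> complex) \<Rightarrow> complex" where
  "multiplier_symbol T \<phi> = (THE t. \<forall>x. \<phi> (T x) = t * \<phi> x)"

text \<open>
  Choose \<open>w\<close> with \<open>\<phi> w = 1\<close> and apply \<open>\<phi>\<close> to \<open>T x * w = x * T w\<close>.
\<close>

lemma multiplier_symbol:
  assumes T: "multiplier T" and \<phi>: "\<phi> \<in> gelfand_space"
  shows "\<phi> (T x) = multiplier_symbol T \<phi> * \<phi> x"
proof -
  obtain w where w: "\<phi> w = 1" using character_nonzero[OF \<phi>] .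
  have "\<phi> (T x) = \<phi> (T w) * \<phi> x" for x
  proof -
    have "\<phi> (T x * w) = \<phi> (x * T w)" using T unfolding multiplier_def by simp
    then show ?thesis by (simp add: characterD[OF \<phi>] w)
  qed
  then have "\<exists>!t. \<forall>x. \<phi> (T x) = t * \<phi> x" using w by (metis mult.right_neutral)
  from theI'[OF this] show ?thesis unfolding multiplier_symbol_def by blast
qed

text \<open>
  Linearity is checked on the symbol, and the graph of \<open>T\<close> is closed because characters are continuous
  and separate points.
\<close>

lemma multiplier_bounded_clinear:
  fixes T :: "'a::comm_complex_banach_algebra \<Rightarrow> 'a"
  assumes ss: "semisimple_algebra TYPE('a)" and T: "multiplier T"
  shows "bounded_clinear T"
proof -
  note sym = multiplier_symbol[OF T]
  have cs: "T (c *\<^sub>C x) = c *\<^sub>C T x" for c x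
  proof (rule semisimple_eqI[OF ss])
    fix \<phi> :: "'a \<Rightarrow> complex" assume \<phi>: "\<phi> \<in> gelfand_space"
    show "\<phi> (T (c *\<^sub>C x)) = \<phi> (c *\<^sub>C T x)" by (simp add: characterD[OF \<phi>] sym[OF \<phi>])
  qed
  have add: "T (x + y) = T x + T y" for x y
  proof (rule semisimple_eqI[OF ss])
    fix \<phi> :: "'a \<Rightarrow> complex" assume \<phi>: "\<phi> \<in> gelfand_space"
    show "\<phi> (T (x + y)) = \<phi> (T x + T y)" by (simp add: characterD[OF \<phi>] sym[OF \<phi>] distrib_left)
  qed
  have "bounded_linear T"
  proof (rule closed_graph_bounded_linear)
    show "linear T" by (rule linearI) (simp_all add: add cs scaleR_scaleC)
    fix x l m assume x: "x \<longlonglongrightarrow> l" and Tx: "(\<lambda>n. T (x n)) \<longlonglongrightarrow> m"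
    have lim: "(\<lambda>n. \<phi> (y n)) \<longlonglongrightarrow> \<phi> k" if \<phi>: "\<phi> \<in> gelfand_space" and y: "y \<longlonglongrightarrow> k"
      for \<phi> and y :: "nat \<Rightarrow> 'a" and k
    proof (rule LIM_zero_cancel, rule Lim_null_comparison)
      show "\<forall>\<^sub>F n in sequentially. norm (\<phi> (y n) - \<phi> k) \<le> norm (y n - k)"
        using character_norm_le[OF \<phi>] by (simp flip: characterD(5)[OF \<phi>])
      show "(\<lambda>n. norm (y n - k)) \<longlonglongrightarrow> 0" using y LIM_zero tendsto_norm_zero by blast
    qed
    show "T l = m"
    proof (rule semisimple_eqI[OF ss])
      fix \<phi> :: "'a \<Rightarrow> complex" assume \<phi>: "\<phi> \<in> gelfand_space"
      have "(\<lambda>n. multiplier_symbol T \<phi> * \<phi> (x n)) \<longlonglongrightarrow> multiplier_symbol T \<phi> * \<phi> l"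
        by (intro tendsto_intros lim[OF \<phi> x])
      then have "(\<lambda>n. \<phi> (T (x n))) \<longlonglongrightarrow> \<phi> (T l)" by (simp add: sym[OF \<phi>])
      then show "\<phi> (T l) = \<phi> m" using lim[OF \<phi> Tx] LIMSEQ_unique by blast
    qed
  qed
  then show ?thesis using cs unfolding bounded_clinear_def by blast
qed

text \<open>
  The character \<open>\<phi>\<close> vanishes on the range of \<open>T - t \<phi>\<close>, which is therefore not the whole algebra.
\<close>

lemma multiplier_symbol_in_spectrum:
  assumes T: "multiplier T" and \<phi>: "\<phi> \<in> gelfand_space"
  shows "multiplier_symbol T \<phi> \<in> op_spectrum T"
proof (rule ccontr)
  assume "multiplier_symbol T \<phi> \<notin> op_spectrum T"
  then obtain S where S: "\<And>x. T (S x) - multiplier_symbol T \<phi> *\<^sub>C S x = x"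
    unfolding op_spectrum_def by blast
  obtain w where w: "\<phi> w = 1" using character_nonzero[OF \<phi>] .
  have "\<phi> (T (S w) - multiplier_symbol T \<phi> *\<^sub>C S w) = 0"
    by (simp add: characterD[OF \<phi>] multiplier_symbol[OF T \<phi>])
  then show False using S w by simp
qed

lemma closed_csubspace_kernel:
  fixes F :: "('a::comm_complex_banach_algebra \<Rightarrow> complex) set"
  assumes "F \<subseteq> gelfand_space"
  shows "closed_csubspace {x. \<forall>\<phi>\<in>F. \<phi> x = 0}"
proof -
  have "closed {x. \<phi> x = 0}" if \<phi>: "\<phi> \<in> F" for \<phi>
  proof -
    have \<phi>': "\<phi> \<in> gelfand_space" using assms \<phi> by blast
    have "\<phi> (s *\<^sub>R x) = s *\<^sub>R \<phi> x" for s x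
      unfolding scaleR_scaleC[where 'a = 'a] by (simp add: characterD[OF \<phi>'] scaleR_conv_of_real)
    then have "bounded_linear \<phi>"
      by (intro bounded_linear_intro[where K=1]) (simp_all add: characterD[OF \<phi>'] character_norm_le[OF \<phi>'])
    then have "continuous_on UNIV \<phi>" by (rule linear_continuous_on)
    then show ?thesis by (intro closed_Collect_eq) auto
  qed
  then have "closed (\<Inter>\<phi>\<in>F. {x. \<phi> x = 0})" by (rule closed_INT[OF ballI])
  moreover have "(\<Inter>\<phi>\<in>F. {x. \<phi> x = 0}) = {x. \<forall>\<phi>\<in>F. \<phi> x = 0}" by auto
  ultimately have "closed {x. \<forall>\<phi>\<in>F. \<phi> x = 0}" by simp
  moreover have "\<phi> (x + y) = 0" "\<phi> (c *\<^sub>C x) = 0" if "\<phi> \<in> F" "\<phi> x = 0" "\<phi> y = 0" for \<phi> c x y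
    using that(2,3) characterD[OF subsetD[OF assms that(1)]] by auto
  moreover have "\<phi> 0 = 0" if "\<phi> \<in> F" for \<phi> using characterD(4)[OF subsetD[OF assms that]] .
  ultimately show ?thesis unfolding closed_csubspace_def by blast
qed

text \<open>
  On elements annihilated by the characters of symbol \<open>0\<close> the multiplier is inverted by the mean of
  its resolvent; on those annihilated by all other characters it is zero.
\<close>

lemma generalized_drazin_imp_pseudo_fredholm:
  fixes T :: "'a::comm_complex_banach_algebra \<Rightarrow> 'a"
  assumes ss: "semisimple_algebra TYPE('a)" and T: "multiplier T"
    and drazin: "generalized_drazin_invertible T"
  shows "pseudo_fredholm T"
proof -
  note sym = multiplier_symbol[OF T]
  have blT: "bounded_clinear T" by (rule multiplier_bounded_clinear[OF ss T])
  then have linT: "linear T" unfolding bounded_clinear_def using bounded_linear.linear by blast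
  obtain e where e: "e > 0" "\<And>\<mu>. \<mu> \<in> op_spectrum T \<Longrightarrow> \<mu> \<noteq> 0 \<Longrightarrow> e \<le> cmod \<mu>"
    using drazin unfolding generalized_drazin_invertible_def islimpt_approachable by (auto simp: not_less)
  define r where "r = e / 2"
  have r: "r > 0" "r < e" using e by (auto simp: r_def)
  have gap: "multiplier_symbol T \<phi> = 0 \<or> r < cmod (multiplier_symbol T \<phi>)" if "\<phi> \<in> gelfand_space" for \<phi>
    using e(2)[OF multiplier_symbol_in_spectrum[OF T that]] r by fastforce
  have "\<exists>b. \<forall>\<phi>\<in>gelfand_space. \<phi> b = (if multiplier_symbol T \<phi> = 0 then 0 else \<phi> x / multiplier_symbol T \<phi>)" for x
  proof -
    have "\<exists>S. bounded_clinear S \<and> S ` {0} \<subseteq> {0} \<and>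
      (\<forall>y. T (S y) - \<mu> *\<^sub>C S y - y \<in> {0}) \<and> (\<forall>y. S (T y - \<mu> *\<^sub>C y) - y \<in> {0})" if "cmod \<mu> = r" for \<mu>
    proof -
      have "\<mu> \<notin> op_spectrum T" using e(2)[of \<mu>] that r by auto
      then obtain S where S: "bounded_clinear S" "\<forall>x. S (T x - \<mu> *\<^sub>C x) = x" "\<forall>x. T (S x) - \<mu> *\<^sub>C S x = x"
        unfolding op_spectrum_def by blast
      then have "S 0 = 0" unfolding bounded_clinear_def using bounded_linear.linear linear_0 by blast
      with S show ?thesis by (intro exI[of _ S]) auto
    qed
    from resolvent_average[OF closed_csubspace_zero r(1) linT this, of x]
    obtain b where b: "\<And>\<psi> t. \<lbrakk>\<And>y z. \<psi> (y + z) = \<psi> y + \<psi> z; \<And>c y. \<psi> (c *\<^sub>C y) = c * \<psi> y;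
      \<And>y. cmod (\<psi> y) \<le> norm y; \<And>h. h \<in> {0} \<Longrightarrow> \<psi> h = 0; \<And>y. \<psi> (T y) = t * \<psi> y;
      t = 0 \<or> r < cmod t\<rbrakk> \<Longrightarrow> \<psi> b = (if t = 0 then 0 else \<psi> x / t)" by blast
    show ?thesis
    proof (intro exI[of _ b] ballI)
      fix \<phi> :: "'a \<Rightarrow> complex" assume \<phi>: "\<phi> \<in> gelfand_space"
      show "\<phi> b = (if multiplier_symbol T \<phi> = 0 then 0 else \<phi> x / multiplier_symbol T \<phi>)"
        by (rule b) (use gap[OF \<phi>] in \<open>auto simp: characterD[OF \<phi>] character_norm_le[OF \<phi>] sym[OF \<phi>]\<close>)
    qed
  qed
  then obtain B where B: "\<And>x \<phi>. \<phi> \<in> gelfand_space \<Longrightarrow>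
      \<phi> (B x) = (if multiplier_symbol T \<phi> = 0 then 0 else \<phi> x / multiplier_symbol T \<phi>)"
    by metis
  \<comment> \<open>These two subspaces turn out to be the range and the kernel of \<open>T\<close>.\<close>
  define M where "M = {x. \<forall>\<phi>\<in>{\<phi>\<in>gelfand_space. multiplier_symbol T \<phi> = 0}. \<phi> x = 0}"
  define N where "N = {x. \<forall>\<phi>\<in>{\<phi>\<in>gelfand_space. multiplier_symbol T \<phi> \<noteq> 0}. \<phi> x = 0}"
  have cM: "closed_csubspace M" unfolding M_def by (rule closed_csubspace_kernel) blast
  have cN: "closed_csubspace N" unfolding N_def by (rule closed_csubspace_kernel) blast
  have TM: "T x \<in> M" for x
  proof -
    have "\<phi> (T x) = 0" if "\<phi> \<in> gelfand_space" "multiplier_symbol T \<phi> = 0" for \<phi>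
      using that(2) by (simp add: sym[OF that(1)])
    then show ?thesis unfolding M_def by blast
  qed
  have BM: "B x \<in> M" for x
  proof -
    have "\<phi> (B x) = 0" if "\<phi> \<in> gelfand_space" "multiplier_symbol T \<phi> = 0" for \<phi>
      using that(2) by (simp add: B[OF that(1)])
    then show ?thesis unfolding M_def by blast
  qed
  have TB: "T (B x) = x" if "x \<in> M" for x
  proof (rule semisimple_eqI[OF ss])
    fix \<phi> :: "'a \<Rightarrow> complex" assume \<phi>: "\<phi> \<in> gelfand_space"
    show "\<phi> (T (B x)) = \<phi> x" using that \<phi> by (simp add: sym[OF \<phi>] B[OF \<phi>] M_def)
  qed
  have TN: "T x = 0" if "x \<in> N" for x
  proof (rule semisimple_eqI[OF ss])
    fix \<phi> :: "'a \<Rightarrow> complex" assume \<phi>: "\<phi> \<in> gelfand_space"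
    show "\<phi> (T x) = \<phi> 0" using that \<phi> by (auto simp: sym[OF \<phi>] N_def characterD[OF \<phi>])
  qed
  have MN: "x = 0" if "x \<in> M" "T x = 0" for x
  proof (rule semisimple_eqI[OF ss])
    fix \<phi> :: "'a \<Rightarrow> complex" assume \<phi>: "\<phi> \<in> gelfand_space"
    have "multiplier_symbol T \<phi> * \<phi> x = 0" using sym[OF \<phi>, of x] that by (simp add: characterD[OF \<phi>])
    then show "\<phi> x = \<phi> 0" using that \<phi> by (auto simp: M_def characterD[OF \<phi>])
  qed
  have TMM: "T ` M = M" using TM TB BM by (metis (no_types, lifting) image_subset_iff subsetI image_eqI subset_antisym)
  show ?thesis
    unfolding pseudo_fredholm_def
  proof (rule exI[of _ M], rule exI[of _ N], intro conjI allI)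
    show "M \<inter> N = {0}" using MN TN closed_csubspaceD(2)[OF cM] closed_csubspaceD(2)[OF cN] by blast
    show "T ` N \<subseteq> N" using TN closed_csubspaceD(2)[OF cN] by auto
    show "\<exists>u\<in>M. \<exists>v\<in>N. x = u + v" for x
    proof (rule bexI[of _ "T (B x)"], rule bexI[of _ "x - T (B x)"])
      show "x = T (B x) + (x - T (B x))" by simp
      have "\<phi> (x - T (B x)) = 0" if \<phi>: "\<phi> \<in> gelfand_space" "multiplier_symbol T \<phi> \<noteq> 0" for \<phi>
        using \<phi>(2) by (simp add: characterD[OF \<phi>(1)] sym[OF \<phi>(1)] B[OF \<phi>(1)])
      then show "x - T (B x) \<in> N" unfolding N_def by blast
    qed (rule TM)
    have "{x \<in> M. T x = 0} \<subseteq> {0}" using MN by blast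
    moreover have "0 \<in> (T ^^ n) ` M" for n
    proof -
      have "(T ^^ n) 0 = 0" by (induction n) (simp_all add: linear_0[OF linT])
      then show ?thesis using closed_csubspaceD(2)[OF cM] by (metis image_eqI)
    qed
    ultimately have "{x \<in> M. T x = 0} \<subseteq> (\<Inter>n. (T ^^ n) ` M)" by blast
    moreover have "closedin (top_of_set M) (T ` M)" using TMM closedin_subtopology_refl[of euclidean M] by simp
    ultimately show "semi_regular_on M T" unfolding semi_regular_on_def by (rule conjI[rotated])
    have "op_norm_on N (T ^^ n) = 0" if n: "n > 0" for n
    proof -
      obtain k where k: "n = Suc k" using gr0_implies_Suc[OF n] by blast
      have "(T ^^ k) 0 = 0" for k by (induction k) (simp_all add: linear_0[OF linT])
      then have "(T ^^ n) x = 0" if "x \<in> N" for x using TN[OF that] unfolding k by (simp add: funpow_Suc_right del: funpow.simps)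
      then have "(\<lambda>x. norm ((T ^^ n) x)) ` {x \<in> N. norm x \<le> 1} = {0}"
        using closed_csubspaceD(2)[OF cN] by (auto simp: image_iff intro!: bexI[of _ 0])
      then show ?thesis unfolding op_norm_on_def by simp
    qed
    then have "root n (op_norm_on N (T ^^ n)) = 0" for n by (cases "n = 0") simp_all
    then show "quasinilpotent_on N T" unfolding quasinilpotent_on_def by simp
  qed (use cM cN TMM in auto)
qed

section \<open>Units on compact sets of characters\<close>

lemma algebra_ideal_kernel:
  fixes F :: "('a::comm_complex_banach_algebra \<Rightarrow> complex) set"
  assumes "F \<subseteq> gelfand_space"
  shows "algebra_ideal {x. \<forall>\<phi>\<in>F. \<phi> x = 0}"
proof -
  have "\<phi> (x * y) = 0" if "\<phi> \<in> F" "\<phi> x = 0" for \<phi> x y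
    using that(2) characterD(3)[OF subsetD[OF assms that(1)]] by auto
  then show ?thesis
    using closed_csubspace_kernel[OF assms] unfolding closed_csubspace_def algebra_ideal_def by blast
qed

lemma regular_hull_kernel:
  fixes F :: "('a::comm_complex_banach_algebra \<Rightarrow> complex) set"
  assumes "regular_algebra TYPE('a)" "closedin gelfand_topology F" "\<phi> \<in> gelfand_space"
    "\<And>x. (\<forall>\<psi>\<in>F. \<psi> x = 0) \<Longrightarrow> \<phi> x = 0"
  shows "\<phi> \<in> F"
  using assms unfolding regular_algebra_def gelfand_transform_def by blast

lemma closedin_gelfand_le:
  assumes "continuous_on UNIV f" "continuous_on UNIV g"
  shows "closedin gelfand_topology {\<phi> \<in> gelfand_space. f \<phi> \<le> (g \<phi> :: real)}"
proof -
  have "closed {\<phi>. f \<phi> \<le> g \<phi>}" using assms by (intro closed_Collect_le)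
  then have "closedin gelfand_topology (gelfand_space \<inter> {\<phi>. f \<phi> \<le> g \<phi>})" by (rule closedin_closed_Int)
  moreover have "gelfand_space \<inter> {\<phi>. f \<phi> \<le> g \<phi>} = {\<phi> \<in> gelfand_space. f \<phi> \<le> g \<phi>}" by auto
  ultimately show ?thesis by simp
qed

lemma continuous_on_cmod_eval: "continuous_on UNIV (\<lambda>\<phi>. cmod (\<phi> w))"
  by (intro continuous_intros continuous_on_product_coordinates)

text \<open>
  Modulo the kernel \<open>H\<close> of \<open>F\<close> the spectrum of \<open>w\<close> is \<open>w(F)\<close>, together with \<open>0\<close> as far as can be seen
  before a unit is known. It does not meet a small circle around \<open>0\<close>, so the mean of the resolvent of
  multiplication by \<open>w\<close>, applied to \<open>w\<close> itself, exists, and it takes the value \<open>\<phi> w / \<phi> w = 1\<close> on \<open>F\<close>.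
\<close>

lemma local_unit:
  fixes w :: "'a::comm_complex_banach_algebra"
  assumes reg: "regular_algebra TYPE('a)" and F: "closedin gelfand_topology F"
    and \<rho>: "\<rho> > 0" and w: "\<And>\<phi>. \<phi> \<in> F \<Longrightarrow> \<rho> \<le> cmod (\<phi> w)"
  obtains e where "\<And>\<phi>. \<phi> \<in> F \<Longrightarrow> \<phi> e = 1"
proof -
  have FG: "F \<subseteq> gelfand_space" using closedin_subset[OF F] by simp
  have chF: "\<phi> \<in> gelfand_space" if "\<phi> \<in> F" for \<phi> using that FG by blast
  define H where "H = {x. \<forall>\<phi>\<in>F. \<phi> x = 0}"
  have csH: "closed_csubspace H" unfolding H_def by (rule closed_csubspace_kernel[OF FG])
  have idH: "algebra_ideal H" unfolding H_def by (rule algebra_ideal_kernel[OF FG])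
  define r where "r = \<rho> / 2"
  have r: "r > 0" "r < \<rho>" using \<rho> by (auto simp: r_def)
  have "\<exists>S. bounded_clinear S \<and> S ` H \<subseteq> H \<and> (\<forall>y. w * S y - \<mu> *\<^sub>C S y - y \<in> H) \<and> (\<forall>y. S (w * y - \<mu> *\<^sub>C y) - y \<in> H)"
    if \<mu>: "cmod \<mu> = r" for \<mu>
  proof -
    have \<mu>0: "\<mu> \<noteq> 0" using \<mu> r by auto
    have wmu: "\<phi> w \<noteq> \<mu>" if "\<phi> \<in> F" for \<phi> using w[OF that] \<mu> r by auto
    \<comment> \<open>For \<open>\<mu> \<noteq> 0\<close> this ideal is modular with unit \<open>w / \<mu>\<close>, although \<open>H\<close> is not yet known to be modular.\<close>
    define J where "J = {(w * v - \<mu> *\<^sub>C v) + h | v h. h \<in> H}"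
    have "w * (x + y) - \<mu> *\<^sub>C (x + y) = (w * x - \<mu> *\<^sub>C x) + (w * y - \<mu> *\<^sub>C y)"
      "w * (c *\<^sub>C x) - \<mu> *\<^sub>C c *\<^sub>C x = c *\<^sub>C (w * x - \<mu> *\<^sub>C x)"
      "(w * x - \<mu> *\<^sub>C x) * y = w * (x * y) - \<mu> *\<^sub>C (x * y)" for c x y
      by (simp_all add: distrib_left left_diff_distrib scaleC_add_right scaleC_diff_right scaleC_scaleC
            mult_scaleC_left mult_scaleC_right mult.assoc mult.commute[of c])
    note range_plus = algebra_ideal_range_plus[of "\<lambda>v. w * v - \<mu> *\<^sub>C v", OF this idH]
    have J: "algebra_ideal J" and J1: "w * v - \<mu> *\<^sub>C v \<in> J" and J2: "h \<in> H \<Longrightarrow> h \<in> J" for v h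
      unfolding J_def by (fact range_plus)+
    define u where "u = (1 / \<mu>) *\<^sub>C w"
    have "u * y - y \<in> J" for y
    proof -
      have "u * y - y = (1 / \<mu>) *\<^sub>C (w * y - \<mu> *\<^sub>C y)"
        unfolding u_def using \<mu>0 by (simp add: scaleC_diff_right scaleC_scaleC mult_scaleC_left)
      then show ?thesis using algebra_idealD(3)[OF J J1] by simp
    qed
    have "u \<in> J"
    proof (rule ccontr)
      assume "u \<notin> J"
      then obtain \<phi> where \<phi>: "\<phi> \<in> gelfand_space" "\<And>x. x \<in> J \<Longrightarrow> \<phi> x = 0"
        using modular_ideal_character[OF J \<open>\<And>y. u * y - y \<in> J\<close>] by blast
      have "\<phi> \<in> F" using regular_hull_kernel[OF reg F \<phi>(1)] \<phi>(2) J2 unfolding H_def by blast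
      obtain v where "\<phi> v = 1" using character_nonzero[OF \<phi>(1)] .
      then have "\<phi> w = \<mu>" using \<phi>(2)[OF J1[of v]] by (simp add: characterD[OF \<phi>(1)])
      then show False using wmu \<open>\<phi> \<in> F\<close> by blast
    qed
    then obtain v h where v: "u = (w * v - \<mu> *\<^sub>C v) + h" "h \<in> H" unfolding J_def by blast
    have v': "(\<phi> w - \<mu>) * (\<phi> v - 1 / \<mu>) = 1" if "\<phi> \<in> F" for \<phi>
    proof -
      have "\<phi> u = \<phi> w / \<mu>" unfolding u_def by (simp add: characterD[OF chF[OF that]])
      moreover have "\<phi> u = (\<phi> w - \<mu>) * \<phi> v"
        using v that unfolding H_def by (simp add: characterD[OF chF[OF that]] left_diff_distrib)
      ultimately show ?thesis using \<mu>0 by (simp add: field_simps)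
    qed
    \<comment> \<open>The inverse of \<open>w - \<mu>\<close> modulo \<open>H\<close>, where \<open>v\<close> solves \<open>(w - \<mu>) v = w / \<mu>\<close>.\<close>
    define S where "S y = v * y - (1 / \<mu>) *\<^sub>C y" for y
    have S: "\<phi> (S y) = (\<phi> v - 1 / \<mu>) * \<phi> y" if "\<phi> \<in> F" for \<phi> y
      by (simp add: S_def characterD[OF chF[OF that]] left_diff_distrib)
    have "bounded_linear S" unfolding S_def
      by (intro bounded_linear_sub bounded_linear_mult_right bounded_linear_scaleC)
    then have "bounded_clinear S"
      unfolding bounded_clinear_def
      by (simp add: S_def mult_scaleC_right scaleC_diff_right scaleC_scaleC mult.commute)
    moreover have "S ` H \<subseteq> H" unfolding H_def by (auto simp: S)
    moreover have "w * S y - \<mu> *\<^sub>C S y - y \<in> H" for y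
      unfolding H_def
    proof (intro CollectI ballI)
      fix \<phi> assume \<phi>: "\<phi> \<in> F"
      have "\<phi> (w * S y - \<mu> *\<^sub>C S y - y) = (\<phi> w - \<mu>) * (\<phi> v - 1 / \<mu>) * \<phi> y - \<phi> y"
        by (simp add: characterD[OF chF[OF \<phi>]] S[OF \<phi>] left_diff_distrib mult.assoc)
      then show "\<phi> (w * S y - \<mu> *\<^sub>C S y - y) = 0" using v'[OF \<phi>] by simp
    qed
    moreover have "S (w * y - \<mu> *\<^sub>C y) - y \<in> H" for y
      unfolding H_def
    proof (intro CollectI ballI)
      fix \<phi> assume \<phi>: "\<phi> \<in> F"
      have "\<phi> (S (w * y - \<mu> *\<^sub>C y) - y) = (\<phi> w - \<mu>) * (\<phi> v - 1 / \<mu>) * \<phi> y - \<phi> y"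
        by (simp add: characterD[OF chF[OF \<phi>]] S[OF \<phi>] algebra_simps)
      then show "\<phi> (S (w * y - \<mu> *\<^sub>C y) - y) = 0" using v'[OF \<phi>] by simp
    qed
    ultimately show ?thesis by blast
  qed
  from resolvent_average[OF csH r(1) bounded_linear.linear[OF bounded_linear_mult_right] this, of w]
  obtain b where b: "\<And>\<psi> t. \<lbrakk>\<And>y z. \<psi> (y + z) = \<psi> y + \<psi> z; \<And>c y. \<psi> (c *\<^sub>C y) = c * \<psi> y;
      \<And>y. cmod (\<psi> y) \<le> norm y; \<And>h. h \<in> H \<Longrightarrow> \<psi> h = 0; \<And>y. \<psi> (w * y) = t * \<psi> y;
      t = 0 \<or> r < cmod t\<rbrakk> \<Longrightarrow> \<psi> b = (if t = 0 then 0 else \<psi> w / t)" by blast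
  have "\<phi> b = 1" if \<phi>: "\<phi> \<in> F" for \<phi>
  proof -
    have "r < cmod (\<phi> w)" using w[OF \<phi>] r by simp
    moreover from this have "\<phi> w \<noteq> 0" using r by auto
    moreover have "\<phi> b = (if \<phi> w = 0 then 0 else \<phi> w / \<phi> w)"
      by (rule b) (use \<phi> calculation in \<open>auto simp: characterD[OF chF[OF \<phi>]] character_norm_le[OF chF[OF \<phi>]] H_def\<close>)
    ultimately show ?thesis by simp
  qed
  then show ?thesis using that by blast
qed

text \<open>
  Finitely many local units cover a compact set, and \<open>e + f - e * f\<close> is \<open>1\<close> wherever \<open>e\<close> or \<open>f\<close> is.
\<close>

lemma compact_unit:
  fixes K :: "('a::comm_complex_banach_algebra \<Rightarrow> complex) set"
  assumes reg: "regular_algebra TYPE('a)" and K: "compactin gelfand_topology K"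
  obtains e where "\<And>\<phi>. \<phi> \<in> K \<Longrightarrow> \<phi> e = 1"
proof -
  define U where "U w = {\<phi> \<in> gelfand_space. 1/2 < cmod (\<phi> w)}" for w :: 'a
  have KG: "K \<subseteq> gelfand_space" using compactin_subset_topspace[OF K] by simp
  have "openin gelfand_topology (U w)" for w
  proof -
    have "open {\<phi> :: 'a \<Rightarrow> complex. 1/2 < cmod (\<phi> w)}"
      by (intro open_Collect_less continuous_on_cmod_eval continuous_on_const)
    then have "openin gelfand_topology (gelfand_space \<inter> {\<phi>. 1/2 < cmod (\<phi> w)})" by (rule openin_open_Int)
    moreover have "gelfand_space \<inter> {\<phi>. 1/2 < cmod (\<phi> w)} = U w" unfolding U_def by auto
    ultimately show ?thesis by simp
  qed
  moreover have "K \<subseteq> \<Union>(range U)"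
  proof
    fix \<phi> assume "\<phi> \<in> K"
    then have \<phi>: "\<phi> \<in> gelfand_space" using KG by blast
    then obtain w where "\<phi> w = 1" using character_nonzero by blast
    then have "\<phi> \<in> U w" using \<phi> unfolding U_def by simp
    then show "\<phi> \<in> \<Union>(range U)" by blast
  qed
  ultimately obtain \<F> where \<F>: "finite \<F>" "\<F> \<subseteq> range U" "K \<subseteq> \<Union>\<F>"
    using compactinD[OF K, of "range U"] by blast
  then obtain W where W: "finite W" "\<F> = U ` W" by (meson finite_subset_image)
  have "\<exists>e. \<forall>\<phi>\<in>gelfand_space. (\<exists>w\<in>W. 1/2 \<le> cmod (\<phi> w)) \<longrightarrow> \<phi> e = 1"
    using W(1)
  proof (induction W)
    case (insert w W)
    then obtain e where e: "\<forall>\<phi>\<in>gelfand_space. (\<exists>w\<in>W. 1/2 \<le> cmod (\<phi> w)) \<longrightarrow> \<phi> e = 1" by blast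
    obtain f where f: "\<And>\<phi>. \<phi> \<in> {\<phi> \<in> gelfand_space. 1/2 \<le> cmod (\<phi> w)} \<Longrightarrow> \<phi> f = 1"
      using local_unit[OF reg closedin_gelfand_le[OF continuous_on_const[of _ "1/2"] continuous_on_cmod_eval[of w]], of "1/2" w]
      by auto
    show ?case
    proof (intro exI[of _ "e + f - e * f"] ballI impI)
      fix \<phi> :: "'a \<Rightarrow> complex" assume \<phi>: "\<phi> \<in> gelfand_space" "\<exists>v\<in>insert w W. 1/2 \<le> cmod (\<phi> v)"
      then have "\<phi> e = 1 \<or> \<phi> f = 1" using e f by blast
      then show "\<phi> (e + f - e * f) = 1" by (auto simp: characterD[OF \<phi>(1)])
    qed
  qed auto
  then obtain e where e: "\<And>\<phi>. \<phi> \<in> gelfand_space \<Longrightarrow> \<exists>w\<in>W. 1/2 \<le> cmod (\<phi> w) \<Longrightarrow> \<phi> e = 1" by blast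
  have "\<phi> e = 1" if \<phi>: "\<phi> \<in> K" for \<phi>
  proof (rule e)
    show "\<phi> \<in> gelfand_space" using \<phi> KG by blast
    obtain w where "w \<in> W" "\<phi> \<in> U w" using \<F>(3) W(2) \<phi> by blast
    then show "\<exists>w\<in>W. 1/2 \<le> cmod (\<phi> w)" unfolding U_def by (auto intro!: bexI[of _ w])
  qed
  then show ?thesis using that by blast
qed


section \<open>Pseudo-Fredholm multipliers\<close>

text \<open>
  Surjectivity of \<open>T - \<nu>\<close> on \<open>Y\<close> persists within the lower bound \<open>\<kappa>\<close>: with a right inverse \<open>G\<close> of
  \<open>T - \<nu>\<close>, the equation \<open>(T - \<mu>) y = v\<close> is the fixed point equation \<open>y = G (v + (\<mu> - \<nu>) y)\<close>.
\<close>

lemma bounded_below_surjective_perturb: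
  fixes T :: "'a::complex_banach \<Rightarrow> 'a"
  assumes T: "linear T" and Y: "closed_csubspace Y"
    and below: "\<And>y. y \<in> Y \<Longrightarrow> \<kappa> * norm y \<le> norm (T y - \<nu> *\<^sub>C y)"
    and surj: "\<And>v. v \<in> Y \<Longrightarrow> \<exists>y\<in>Y. T y - \<nu> *\<^sub>C y = v"
    and \<mu>: "cmod (\<mu> - \<nu>) < \<kappa>" and v: "v \<in> Y"
  obtains y where "y \<in> Y" "T y - \<mu> *\<^sub>C y = v"
proof -
  note memY = closed_csubspaceD[OF Y]
  have \<kappa>: "\<kappa> > 0" using \<mu> by (meson norm_ge_zero order_le_less_trans)
  obtain G where G: "\<And>v. v \<in> Y \<Longrightarrow> G v \<in> Y" "\<And>v. v \<in> Y \<Longrightarrow> T (G v) - \<nu> *\<^sub>C G v = v"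
    using surj by metis
  have arg: "v + (\<mu> - \<nu>) *\<^sub>C y \<in> Y" if "y \<in> Y" for y using v that by (intro memY)
  have "\<exists>!y\<in>Y. G (v + (\<mu> - \<nu>) *\<^sub>C y) = y"
  proof (rule Banach_fix[of Y "cmod (\<mu> - \<nu>) / \<kappa>"])
    show "complete Y" using memY(1) by (simp add: complete_eq_closed)
    show "Y \<noteq> {}" using memY(2) by blast
    show "cmod (\<mu> - \<nu>) / \<kappa> < 1" "0 \<le> cmod (\<mu> - \<nu>) / \<kappa>" using \<mu> \<kappa> by auto
    show "(\<lambda>y. G (v + (\<mu> - \<nu>) *\<^sub>C y)) ` Y \<subseteq> Y" using G(1) arg by blast
    fix y z assume yz: "y \<in> Y" "z \<in> Y"
    define p where "p = G (v + (\<mu> - \<nu>) *\<^sub>C y)"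
    define q where "q = G (v + (\<mu> - \<nu>) *\<^sub>C z)"
    have pq: "p - q \<in> Y" unfolding p_def q_def using G(1) arg yz by (intro memY) auto
    have "T (p - q) - \<nu> *\<^sub>C (p - q) = (T p - \<nu> *\<^sub>C p) - (T q - \<nu> *\<^sub>C q)"
      by (simp add: linear_diff[OF T] scaleC_diff_right)
    also have "\<dots> = (\<mu> - \<nu>) *\<^sub>C (y - z)"
      unfolding p_def q_def using G(2) arg yz by (simp add: scaleC_diff_right)
    finally have "\<kappa> * norm (p - q) \<le> cmod (\<mu> - \<nu>) * norm (y - z)"
      using below[OF pq] by (simp add: norm_scaleC)
    then show "dist (G (v + (\<mu> - \<nu>) *\<^sub>C y)) (G (v + (\<mu> - \<nu>) *\<^sub>C z)) \<le> cmod (\<mu> - \<nu>) / \<kappa> * dist y z"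
      using \<kappa> unfolding p_def q_def dist_norm by (simp add: field_simps)
  qed
  then obtain y where y: "y \<in> Y" "G (v + (\<mu> - \<nu>) *\<^sub>C y) = y" by blast
  then have "T y - \<nu> *\<^sub>C y = v + (\<mu> - \<nu>) *\<^sub>C y" using G(2)[OF arg[OF y(1)]] by simp
  then have "T y - \<mu> *\<^sub>C y = v" by (simp add: scaleC_diff_left algebra_simps)
  with y(1) show ?thesis using that by blast
qed

text \<open>
  On \<open>N\<close> the growth rate of \<open>T ^^ n\<close> bounds the absolute value of the symbol at every character that
  does not vanish on \<open>N\<close>, so the symbol is \<open>0\<close> there.
\<close>

lemma quasinilpotent_on_kernel:
  fixes T :: "'a::comm_complex_banach_algebra \<Rightarrow> 'a"
  assumes ss: "semisimple_algebra TYPE('a)" and T: "multiplier T"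
    and N: "closed_csubspace N" and qn: "quasinilpotent_on N T" and x: "x \<in> N"
  shows "T x = 0"
proof (rule semisimple_eqI[OF ss])
  fix \<phi> :: "'a \<Rightarrow> complex" assume \<phi>: "\<phi> \<in> gelfand_space"
  let ?t = "multiplier_symbol T \<phi>"
  have blT: "bounded_linear T" using multiplier_bounded_clinear[OF ss T] unfolding bounded_clinear_def by blast
  have blTn: "bounded_linear (T ^^ n)" for n
  proof (induction n)
    case (Suc n) then show ?case using bounded_linear_compose[OF blT Suc] by (simp add: o_def)
  qed (simp add: bounded_linear_ident id_def)
  have pow: "\<phi> ((T ^^ n) y) = ?t ^ n * \<phi> y" for n y
    by (induction n) (simp_all add: multiplier_symbol[OF T \<phi>])
  have "?t * \<phi> x = 0"
  proof (cases "\<phi> x = 0")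
    case False
    define y where "y = of_real (1 / norm x) *\<^sub>C x"
    have nx: "norm x > 0" using False characterD(4)[OF \<phi>] by auto
    have y: "y \<in> N" "norm y = 1" "\<phi> y \<noteq> 0"
      using closed_csubspaceD(4)[OF N x] nx False by (auto simp: y_def norm_scaleC norm_divide characterD[OF \<phi>])
    have bound: "cmod ?t ^ n * cmod (\<phi> y) \<le> op_norm_on N (T ^^ n)" for n
    proof -
      have "cmod ?t ^ n * cmod (\<phi> y) = cmod (\<phi> ((T ^^ n) y))" by (simp add: pow norm_mult norm_power)
      also have "\<dots> \<le> norm ((T ^^ n) y)" by (rule character_norm_le[OF \<phi>])
      also have "\<dots> \<le> op_norm_on N (T ^^ n)"
        unfolding op_norm_on_def
      proof (rule cSUP_upper)
        show "y \<in> {x \<in> N. norm x \<le> 1}" using y by simp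
        show "bdd_above ((\<lambda>x. norm ((T ^^ n) x)) ` {x \<in> N. norm x \<le> 1})"
        proof (rule bdd_aboveI2)
          fix z assume "z \<in> {x \<in> N. norm x \<le> 1}"
          then show "norm ((T ^^ n) z) \<le> onorm (T ^^ n) * 1"
            using onorm[OF blTn, of n z] mult_left_mono[of "norm z" 1 "onorm (T ^^ n)"] onorm_pos_le[OF blTn]
            by fastforce
        qed
      qed
      finally show ?thesis .
    qed
    have "cmod ?t * root n (cmod (\<phi> y)) \<le> root n (op_norm_on N (T ^^ n))" if n: "n > 0" for n
    proof -
      have "root n (cmod ?t ^ n * cmod (\<phi> y)) \<le> root n (op_norm_on N (T ^^ n))"
        using bound n by (intro real_root_le_mono) auto
      then show ?thesis using n by (simp add: real_root_mult real_root_power_cancel)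
    qed
    moreover have "(\<lambda>n. cmod ?t * root n (cmod (\<phi> y))) \<longlonglongrightarrow> cmod ?t * 1"
      using y(3) by (intro tendsto_intros LIMSEQ_root_const) simp
    moreover have "(\<lambda>n. root n (op_norm_on N (T ^^ n))) \<longlonglongrightarrow> 0" using qn unfolding quasinilpotent_on_def .
    ultimately have "cmod ?t * 1 \<le> 0" by (intro LIMSEQ_le[of _ _ _ 0]) (auto intro: exI[of _ 1])
    then show ?thesis by simp
  qed simp
  then show "\<phi> (T x) = \<phi> 0" by (simp add: multiplier_symbol[OF T \<phi>] characterD[OF \<phi>])
qed

lemma multiplier_square_kernel:
  fixes T :: "'a::comm_complex_banach_algebra \<Rightarrow> 'a"
  assumes ss: "semisimple_algebra TYPE('a)" and T: "multiplier T" and x: "T (T x) = 0"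
  shows "T x = 0"
proof (rule semisimple_eqI[OF ss])
  fix \<phi> :: "'a \<Rightarrow> complex" assume \<phi>: "\<phi> \<in> gelfand_space"
  have "\<phi> (T (T x)) = 0" using x by (simp add: characterD[OF \<phi>])
  then show "\<phi> (T x) = \<phi> 0" by (auto simp: multiplier_symbol[OF T \<phi>] characterD[OF \<phi>])
qed

lemma multiplier_mult_right:
  fixes T :: "'a::comm_complex_banach_algebra \<Rightarrow> 'a"
  assumes ss: "semisimple_algebra TYPE('a)" and T: "multiplier T"
  shows "T x * y = T (x * y)"
proof (rule semisimple_eqI[OF ss])
  fix \<phi> :: "'a \<Rightarrow> complex" assume \<phi>: "\<phi> \<in> gelfand_space"
  show "\<phi> (T x * y) = \<phi> (T (x * y))" by (simp add: multiplier_symbol[OF T \<phi>] characterD[OF \<phi>])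
qed

text \<open>
  The quasinilpotent summand lies in the kernel. On \<open>M\<close> the operator is injective: the Kato condition
  writes an element of the kernel as \<open>T y\<close>, and \<open>T (T y) = 0\<close> forces \<open>T y = 0\<close>. Closed range then gives
  the lower bound.
\<close>

lemma pseudo_fredholm_multiplier_splitting:
  fixes T :: "'a::comm_complex_banach_algebra \<Rightarrow> 'a"
  assumes ss: "semisimple_algebra TYPE('a)" and T: "multiplier T" and pf: "pseudo_fredholm T"
  obtains M c where "closed_csubspace M" "c > 0" "closed (range T)" "range T \<subseteq> M"
    "\<And>x. x \<in> M \<Longrightarrow> c * norm x \<le> norm (T x)" "\<And>x. \<exists>u\<in>M. \<exists>v. T v = 0 \<and> x = u + v"
proof -
  have blT: "bounded_linear T" using multiplier_bounded_clinear[OF ss T] unfolding bounded_clinear_def by blast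
  note linT = bounded_linear.linear[OF blT]
  obtain M N where M: "closed_csubspace M" and N: "closed_csubspace N" and TM: "T ` M \<subseteq> M"
    and split: "\<And>x. \<exists>u\<in>M. \<exists>v\<in>N. x = u + v"
    and semi: "semi_regular_on M T" and qn: "quasinilpotent_on N T"
    using pf unfolding pseudo_fredholm_def by blast
  note memM = closed_csubspaceD[OF M]
  have TN: "T v = 0" if "v \<in> N" for v using quasinilpotent_on_kernel[OF ss T N qn that] .
  have inj: "x = 0" if "x \<in> M" "T x = 0" for x
  proof -
    have "x \<in> (T ^^ 1) ` M" using semi that unfolding semi_regular_on_def by blast
    then obtain y where "x = T y" by auto
    then show ?thesis using multiplier_square_kernel[OF ss T] that(2) by blast
  qed
  have range: "range T = T ` M"
  proof
    show "range T \<subseteq> T ` M"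
    proof
      fix z assume "z \<in> range T"
      then obtain x where "z = T x" by blast
      moreover obtain u v where "u \<in> M" "v \<in> N" "x = u + v" using split by blast
      ultimately have "z = T u" by (simp add: linear_add[OF linT] TN)
      then show "z \<in> T ` M" using \<open>u \<in> M\<close> by blast
    qed
  qed auto
  have closed: "closed (T ` M)"
    using semi memM(1) closedin_closed_trans unfolding semi_regular_on_def by blast
  obtain C where C: "C > 0" "\<And>y. y \<in> T ` M \<Longrightarrow> \<exists>x\<in>M. T x = y \<and> norm x \<le> C * norm y"
    using open_mapping_bound[OF blT memM(1) closed_csubspace_subspace[OF M] closed] by blast
  show ?thesis
  proof (rule that[OF M, of "1 / C"])
    show "1 / C > 0" using C by simp
    show "closed (range T)" "range T \<subseteq> M" using closed TM by (simp_all add: range)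
    show "\<exists>u\<in>M. \<exists>v. T v = 0 \<and> x = u + v" for x using split[of x] TN by blast
    fix x assume x: "x \<in> M"
    obtain x' where x': "x' \<in> M" "T x' = T x" "norm x' \<le> C * norm (T x)" using C(2)[of "T x"] x by blast
    have "x' - x = 0" by (rule inj[OF memM(5)[OF x'(1) x]]) (simp add: linear_diff[OF linT] x'(2))
    then show "1 / C * norm x \<le> norm (T x)" using x'(3) C(1) by (simp add: field_simps)
  qed
qed

text \<open>
  Suppose that \<open>\<phi>0\<close> vanishes on the range and on the kernel of \<open>T\<close>. Take \<open>a\<close> with \<open>\<phi>0 a \<noteq> 0\<close> supported in
  the closed set \<open>F\<close> of characters on which \<open>w\<close> is bounded away from \<open>0\<close> and the symbol is at most
  \<open>\<epsilon>\<close> in absolute value; then \<open>T a \<noteq> 0\<close>. Let \<open>Y\<close> be the part of the range supported in \<open>F\<close>. A unit on \<open>F\<close> makes the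
  ideal generated by \<open>T - \<nu>\<close> and the kernel of \<open>F\<close> modular, so \<open>T - \<nu>\<close> is onto on \<open>Y\<close> for
  \<open>\<nu> = 2 \<epsilon>\<close>. The lower bound of \<open>T\<close> carries this over from \<open>\<nu>\<close> to the symbol \<open>t \<phi>\<close> at a
  character \<open>\<phi>\<close> with \<open>\<phi> (T a) \<noteq> 0\<close>, although \<open>\<phi>\<close> vanishes on the range of \<open>T - t \<phi>\<close>.
\<close>

lemma multiplier_range_kernel_hull_empty:
  fixes T :: "'a::comm_complex_banach_algebra \<Rightarrow> 'a"
  assumes ss: "semisimple_algebra TYPE('a)" and reg: "regular_algebra TYPE('a)" and T: "multiplier T"
    and c: "c > 0" "\<And>x. c * norm (T x) \<le> norm (T (T x))" and closed: "closed (range T)"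
    and \<phi>0: "\<phi>0 \<in> gelfand_space" "\<And>x. \<phi>0 (T x) = 0"
  obtains v where "T v = 0" "\<phi>0 v \<noteq> 0"
proof (rule ccontr)
  assume "\<not> thesis"
  with that have ker: "\<phi>0 v = 0" if "T v = 0" for v using that by blast
  let ?t = "multiplier_symbol T"
  note sym = multiplier_symbol[OF T]
  have bc: "bounded_clinear T" by (rule multiplier_bounded_clinear[OF ss T])
  then have linT: "linear T" and scT: "\<And>c x. T (c *\<^sub>C x) = c *\<^sub>C T x"
    unfolding bounded_clinear_def using bounded_linear.linear by blast+
  \<comment> \<open>With \<open>\<nu> = 2 \<epsilon>\<close>, \<open>T - \<nu>\<close> is bounded below by \<open>c - 2 \<epsilon> = 4 \<epsilon>\<close>, more than the distance, at most \<open>3 \<epsilon>\<close>, from \<open>\<nu>\<close> to symbol values on \<open>F\<close>.\<close>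
  define \<epsilon> where "\<epsilon> = c / 6"
  have \<epsilon>: "\<epsilon> > 0" using c by (simp add: \<epsilon>_def)
  obtain w where w: "\<phi>0 w = 1" using character_nonzero[OF \<phi>0(1)] .
  define F0 where "F0 = {\<phi> \<in> gelfand_space. 1/2 \<le> cmod (\<phi> w)}"
  define F where "F = F0 \<inter> {\<phi> \<in> gelfand_space. cmod (\<phi> (T w)) \<le> \<epsilon> * cmod (\<phi> w)}"
  define C where "C = {\<phi> \<in> gelfand_space. cmod (\<phi> w) \<le> 1/2} \<union> {\<phi> \<in> gelfand_space. \<epsilon> * cmod (\<phi> w) \<le> cmod (\<phi> (T w))}"
  have F0: "closedin gelfand_topology F0"
    unfolding F0_def by (intro closedin_gelfand_le continuous_on_cmod_eval continuous_on_const)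
  have F: "closedin gelfand_topology F"
    unfolding F_def by (intro closedin_Int F0 closedin_gelfand_le continuous_on_cmod_eval continuous_on_mult continuous_on_const)
  have C: "closedin gelfand_topology C"
    unfolding C_def by (intro closedin_Un closedin_gelfand_le continuous_on_cmod_eval continuous_on_mult continuous_on_const)
  have FG: "F \<subseteq> gelfand_space" unfolding F_def by blast
  have small: "cmod (?t \<phi>) \<le> \<epsilon>" if "\<phi> \<in> F" for \<phi>
  proof -
    have \<phi>: "\<phi> \<in> gelfand_space" "1/2 \<le> cmod (\<phi> w)" "cmod (\<phi> (T w)) \<le> \<epsilon> * cmod (\<phi> w)"
      using that unfolding F_def F0_def by auto
    then have "cmod (?t \<phi>) * cmod (\<phi> w) \<le> \<epsilon> * cmod (\<phi> w)" by (simp add: sym[OF \<phi>(1)] norm_mult)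
    moreover have "cmod (\<phi> w) > 0" using \<phi>(2) by linarith
    ultimately show ?thesis by simp
  qed
  have "\<phi>0 \<notin> C" unfolding C_def using w \<phi>0(2)[of w] \<epsilon> by auto
  then obtain a where a: "\<And>\<psi>. \<psi> \<in> C \<Longrightarrow> \<psi> a = 0" "\<phi>0 a \<noteq> 0"
    using reg C \<phi>0(1) unfolding regular_algebra_def gelfand_transform_def by blast
  have aF: "\<phi> \<in> F" if "\<phi> \<in> gelfand_space" "\<phi> a \<noteq> 0" for \<phi>
  proof -
    have "\<phi> \<notin> C" using a(1) that(2) by blast
    then show ?thesis using that(1) unfolding C_def F_def F0_def by auto
  qed
  obtain e where e: "\<And>\<phi>. \<phi> \<in> F \<Longrightarrow> \<phi> e = 1"
  proof -
    obtain e where "\<And>\<phi>. \<phi> \<in> F0 \<Longrightarrow> \<phi> e = 1"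
      using local_unit[OF reg F0, of "1/2" w] unfolding F0_def by auto
    then show ?thesis using that unfolding F_def by blast
  qed
  define H where "H = {x. \<forall>\<phi>\<in>F. \<phi> x = 0}"
  have H: "algebra_ideal H" unfolding H_def by (rule algebra_ideal_kernel[OF FG])
  define \<nu> where "\<nu> = complex_of_real (2 * \<epsilon>)"
  have \<nu>: "cmod \<nu> = 2 * \<epsilon>" using \<epsilon> by (simp add: \<nu>_def)
  define J where "J = {(T v - \<nu> *\<^sub>C v) + h | v h. h \<in> H}"
  have "T (x + y) - \<nu> *\<^sub>C (x + y) = (T x - \<nu> *\<^sub>C x) + (T y - \<nu> *\<^sub>C y)"
    "T (k *\<^sub>C x) - \<nu> *\<^sub>C k *\<^sub>C x = k *\<^sub>C (T x - \<nu> *\<^sub>C x)"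
    "(T x - \<nu> *\<^sub>C x) * y = T (x * y) - \<nu> *\<^sub>C (x * y)" for k x y
    by (simp_all add: linear_add[OF linT] scT left_diff_distrib scaleC_add_right scaleC_diff_right scaleC_scaleC
          mult_scaleC_left multiplier_mult_right[OF ss T] mult.commute[of k])
  note range_plus = algebra_ideal_range_plus[of "\<lambda>v. T v - \<nu> *\<^sub>C v", OF this H]
  have J: "algebra_ideal J" and J1: "T v - \<nu> *\<^sub>C v \<in> J" and J2: "h \<in> H \<Longrightarrow> h \<in> J" for v h
    unfolding J_def by (fact range_plus)+
  have "e \<in> J"
  proof (rule ccontr)
    assume "e \<notin> J"
    have "e * y - y \<in> J" for y
    proof (rule J2)
      have "\<phi> (e * y - y) = 0" if "\<phi> \<in> F" for \<phi>
        using e[OF that] by (simp add: characterD[OF subsetD[OF FG that]])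
      then show "e * y - y \<in> H" unfolding H_def by blast
    qed
    then obtain \<phi> where \<phi>: "\<phi> \<in> gelfand_space" "\<And>x. x \<in> J \<Longrightarrow> \<phi> x = 0"
      using modular_ideal_character[OF J _ \<open>e \<notin> J\<close>] by blast
    have "\<phi> \<in> F" using regular_hull_kernel[OF reg F \<phi>(1)] \<phi>(2) J2 unfolding H_def by blast
    obtain v where "\<phi> v = 1" using character_nonzero[OF \<phi>(1)] .
    then have "?t \<phi> = \<nu>" using \<phi>(2)[OF J1[of v]] by (simp add: characterD[OF \<phi>(1)] sym[OF \<phi>(1)])
    then show False using small[OF \<open>\<phi> \<in> F\<close>] \<nu> \<epsilon> by simp
  qed
  then obtain z h where z: "e = (T z - \<nu> *\<^sub>C z) + h" "h \<in> H" unfolding J_def by blast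
  have z1: "(?t \<phi> - \<nu>) * \<phi> z = 1" if \<phi>: "\<phi> \<in> F" for \<phi>
  proof -
    have \<phi>': "\<phi> \<in> gelfand_space" using FG \<phi> by blast
    have "\<phi> h = 0" using z(2) \<phi> unfolding H_def by blast
    then have "\<phi> e = (?t \<phi> - \<nu>) * \<phi> z"
      unfolding z(1) by (simp add: characterD[OF \<phi>'] sym[OF \<phi>'] left_diff_distrib)
    then show ?thesis using e[OF \<phi>] by simp
  qed
  define Y where "Y = range T \<inter> {x. \<forall>\<phi>\<in>gelfand_space - F. \<phi> x = 0}"
  have "closed_csubspace (range T)"
    unfolding closed_csubspace_def using closed linear_0[OF linT]
    by (auto simp: image_iff intro: exI[of _ 0] linear_add[OF linT, symmetric] scT[symmetric])
  moreover have "closed_csubspace {x. \<forall>\<phi>\<in>gelfand_space - F. \<phi> x = (0::complex)}"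
    by (rule closed_csubspace_kernel) blast
  ultimately have Y: "closed_csubspace Y" unfolding Y_def closed_csubspace_def by auto
  have surj: "\<exists>y\<in>Y. T y - \<nu> *\<^sub>C y = v" if v: "v \<in> Y" for v
  \<comment> \<open>Multiplication by \<open>z\<close> inverts \<open>T - \<nu>\<close> on elements supported in \<open>F\<close>.\<close>
  proof (intro bexI[of _ "v * z"])
    have off: "\<phi> v = 0" if "\<phi> \<in> gelfand_space" "\<phi> \<notin> F" for \<phi> using v that unfolding Y_def by blast
    show "T (v * z) - \<nu> *\<^sub>C (v * z) = v"
    proof (rule semisimple_eqI[OF ss])
      fix \<phi> :: "'a \<Rightarrow> complex" assume \<phi>: "\<phi> \<in> gelfand_space"
      have "\<phi> (T (v * z) - \<nu> *\<^sub>C (v * z)) = ((?t \<phi> - \<nu>) * \<phi> z) * \<phi> v"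
        by (simp add: characterD[OF \<phi>] sym[OF \<phi>] algebra_simps)
      then show "\<phi> (T (v * z) - \<nu> *\<^sub>C (v * z)) = \<phi> v" using z1[of \<phi>] off[OF \<phi>] by (cases "\<phi> \<in> F") auto
    qed
    have "\<phi> (v * z) = 0" if "\<phi> \<in> gelfand_space" "\<phi> \<notin> F" for \<phi> using off[OF that] by (simp add: characterD[OF that(1)])
    moreover obtain p where "v = T p" using v unfolding Y_def by blast
    then have "v * z \<in> range T" by (simp add: multiplier_mult_right[OF ss T])
    ultimately show "v * z \<in> Y" unfolding Y_def by blast
  qed
  have below: "(4 * \<epsilon>) * norm y \<le> norm (T y - \<nu> *\<^sub>C y)" if y: "y \<in> Y" for y
  proof -
    have "c * norm y \<le> norm (T y)" using y c(2) unfolding Y_def by auto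
    moreover have "norm (\<nu> *\<^sub>C y) = 2 * \<epsilon> * norm y" by (simp add: norm_scaleC \<nu>)
    ultimately show ?thesis using norm_triangle_ineq2[of "T y" "\<nu> *\<^sub>C y"] by (simp add: \<epsilon>_def field_simps)
  qed
  have "T a \<noteq> 0" using ker a(2) by blast
  then obtain \<phi> where \<phi>: "\<phi> \<in> gelfand_space" "\<phi> (T a) \<noteq> 0"
    using semisimple_eqI[OF ss, of "T a" 0] characterD(4) by metis
  have "\<phi> \<in> F" using aF[OF \<phi>(1)] \<phi>(2) by (simp add: sym[OF \<phi>(1)])
  have "cmod (?t \<phi> - \<nu>) < 4 * \<epsilon>"
    using norm_triangle_ineq4[of "?t \<phi>" \<nu>] small[OF \<open>\<phi> \<in> F\<close>] \<nu> \<epsilon> by simp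
  moreover have "T a \<in> Y"
  proof -
    have "\<psi> (T a) = 0" if "\<psi> \<in> gelfand_space" "\<psi> \<notin> F" for \<psi>
      using aF[OF that(1)] that(2) by (auto simp: sym[OF that(1)])
    then show ?thesis unfolding Y_def by blast
  qed
  ultimately obtain y where "T y - ?t \<phi> *\<^sub>C y = T a"
    using bounded_below_surjective_perturb[OF linT Y below surj] by metis
  then have "\<phi> (T y - ?t \<phi> *\<^sub>C y) \<noteq> 0" using \<phi>(2) by simp
  then show False by (simp add: characterD[OF \<phi>(1)] sym[OF \<phi>(1)])
qed

text \<open>
  The abstract Wiener-Tauberian theorem. A unit \<open>e\<close> on the support of \<open>a\<close> satisfies \<open>e * a = a\<close>, so the
  ideal \<open>Q\<close> of all \<open>z\<close> with \<open>z * a \<in> J\<close> is modular with unit \<open>e\<close>; as \<open>Q\<close> contains \<open>J\<close>, no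
  character vanishes on it, so \<open>e \<in> Q\<close>.
\<close>

lemma compact_support_in_ideal:
  fixes J :: "'a::comm_complex_banach_algebra set"
  assumes ss: "semisimple_algebra TYPE('a)" and reg: "regular_algebra TYPE('a)" and J: "algebra_ideal J"
    and hull: "\<And>\<phi>. \<phi> \<in> gelfand_space \<Longrightarrow> \<exists>x\<in>J. \<phi> x \<noteq> 0"
    and a: "compactin gelfand_topology (gelfand_support a)"
  shows "a \<in> J"
proof -
  obtain e where e: "\<And>\<phi>. \<phi> \<in> gelfand_support a \<Longrightarrow> \<phi> e = 1" using compact_unit[OF reg a] by blast
  have supp: "\<phi> \<in> gelfand_support a" if "\<phi> \<in> gelfand_space" "\<phi> a \<noteq> 0" for \<phi>
  proof -
    have "{\<phi> \<in> gelfand_space. gelfand_transform a \<phi> \<noteq> 0} \<subseteq> gelfand_support a"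
      unfolding gelfand_support_def by (rule closure_of_subset) auto
    then show ?thesis using that unfolding gelfand_transform_def by blast
  qed
  have ea: "e * a = a"
  proof (rule semisimple_eqI[OF ss])
    fix \<phi> :: "'a \<Rightarrow> complex" assume \<phi>: "\<phi> \<in> gelfand_space"
    show "\<phi> (e * a) = \<phi> a" using supp[OF \<phi>] e[of \<phi>] by (auto simp: characterD[OF \<phi>])
  qed
  define Q where "Q = {z. z * a \<in> J}"
  have Q: "algebra_ideal Q"
    unfolding algebra_ideal_def Q_def
    by (auto simp: distrib_right mult_scaleC_left algebra_idealD[OF J] mult.assoc mult.left_commute[of _ _ a])
      (metis algebra_idealD(4)[OF J] mult.assoc mult.commute)
  have "e * y - y \<in> Q" for y
  proof -
    have "(e * y - y) * a = y * (e * a) - y * a" by (simp add: algebra_simps)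
    then show ?thesis unfolding Q_def ea using algebra_idealD(1)[OF J] by simp
  qed
  moreover have "\<exists>x\<in>Q. \<phi> x \<noteq> 0" if "\<phi> \<in> gelfand_space" for \<phi>
    using hull[OF that] algebra_idealD(4)[OF J] unfolding Q_def by blast
  ultimately have "e \<in> Q" using modular_ideal_character[OF Q, of e] by metis
  then show ?thesis unfolding Q_def using ea by simp
qed

text \<open>
  For \<open>m \<in> M\<close> choose \<open>d k = T (p k) + h k\<close> tending to \<open>m\<close> with \<open>T (h k) = 0\<close>. The lower bound turns
  \<open>T (T (p k)) = T (d k) \<longlonglongrightarrow> T m\<close> into \<open>T (p k) \<longlonglongrightarrow> m\<close>, so \<open>T\<close> maps \<open>M\<close> onto \<open>M\<close>. For small
  \<open>\<mu> \<noteq> 0\<close> the operator \<open>T - \<mu>\<close> is then bijective on \<open>M\<close> by perturbation and is \<open>-\<mu>\<close> on the kernel of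
  \<open>T\<close>.
\<close>

lemma pseudo_fredholm_imp_generalized_drazin:
  fixes T :: "'a::comm_complex_banach_algebra \<Rightarrow> 'a"
  assumes ss: "semisimple_algebra TYPE('a)" and reg: "regular_algebra TYPE('a)"
    and taub: "tauberian_algebra TYPE('a)" and T: "multiplier T" and pf: "pseudo_fredholm T"
  shows "generalized_drazin_invertible T"
proof -
  have bc: "bounded_clinear T" by (rule multiplier_bounded_clinear[OF ss T])
  then have blT: "bounded_linear T" and scT: "\<And>c x. T (c *\<^sub>C x) = c *\<^sub>C T x"
    unfolding bounded_clinear_def by blast+
  note linT = bounded_linear.linear[OF blT]
  obtain M c where M: "closed_csubspace M" and c: "c > 0" and closed: "closed (range T)" and TM: "range T \<subseteq> M"
    and below: "\<And>x. x \<in> M \<Longrightarrow> c * norm x \<le> norm (T x)" and split: "\<And>x. \<exists>u\<in>M. \<exists>v. T v = 0 \<and> x = u + v"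
    using pseudo_fredholm_multiplier_splitting[OF ss T pf] by blast
  note memM = closed_csubspaceD[OF M]
  have ker: "algebra_ideal {v. T v = 0}"
    unfolding algebra_ideal_def
    by (auto simp: linear_0[OF linT] linear_add[OF linT] scT simp flip: multiplier_mult_right[OF ss T])
  define J where "J = {T v + h | v h. h \<in> {v. T v = 0}}"
  have J: "algebra_ideal J" and J1: "T v \<in> J" and J2: "h \<in> {v. T v = 0} \<Longrightarrow> h \<in> J" for v h
    unfolding J_def
    by (fact algebra_ideal_range_plus[of T, OF linear_add[OF linT] scT multiplier_mult_right[OF ss T] ker])+
  have hull: "\<exists>x\<in>J. \<phi> x \<noteq> 0" if \<phi>: "\<phi> \<in> gelfand_space" for \<phi>
  proof (rule ccontr)
    assume no: "\<not> ?thesis"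
    then have "\<phi> (T x) = 0" for x using J1 by blast
    then obtain v where "T v = 0" "\<phi> v \<noteq> 0"
      using multiplier_range_kernel_hull_empty[OF ss reg T c _ closed \<phi>] below TM by blast
    then show False using no J2 by blast
  qed
  have surj: "\<exists>u\<in>M. T u - 0 *\<^sub>C u = m" if m: "m \<in> M" for m
  proof -
    have "m \<in> closure {a. compactin gelfand_topology (gelfand_support a)}"
      using taub unfolding tauberian_algebra_def by simp
    then obtain d where d: "\<And>k. compactin gelfand_topology (gelfand_support (d k))" "d \<longlonglongrightarrow> m"
      unfolding closure_sequential by blast
    have "\<exists>p h. d k = T p + h \<and> T h = 0" for k
      using compact_support_in_ideal[OF ss reg J hull d(1)[of k]] unfolding J_def by blast
    then obtain p h where p: "\<And>k. d k = T (p k) + h k" "\<And>k. T (h k) = 0" by metis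
    have le: "norm (T (p k) - m) \<le> norm (T (d k) - T m) / c" for k
    proof -
      have "T (p k) - m \<in> M" using TM m by (intro memM) auto
      from below[OF this] have "c * norm (T (p k) - m) \<le> norm (T (T (p k)) - T m)" by (simp add: linear_diff[OF linT])
      also have "T (T (p k)) = T (d k)" unfolding p(1) by (simp add: linear_add[OF linT] p(2))
      finally show ?thesis using c by (simp add: field_simps)
    qed
    have "(\<lambda>k. norm (T (d k) - T m) / c) \<longlonglongrightarrow> 0"
      by (rule tendsto_divide_zero[OF tendsto_norm_zero[OF LIM_zero[OF bounded_linear.tendsto[OF blT d(2)]]]])
    then have "(\<lambda>k. T (p k) - m) \<longlonglongrightarrow> 0" by (rule Lim_null_comparison[rotated]) (simp add: le)
    then have "(\<lambda>k. T (p k)) \<longlonglongrightarrow> m" by (rule LIM_zero_cancel)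
    then have "m \<in> range T" by (rule closed_sequentially[OF closed, rotated]) simp
    then obtain q where q: "m = T q" by blast
    obtain u v where "u \<in> M" "T v = 0" "q = u + v" using split by blast
    then show ?thesis using q by (auto simp: linear_add[OF linT])
  qed
  have below0: "c * norm x \<le> norm (T x - 0 *\<^sub>C x)" if "x \<in> M" for x using below[OF that] by simp
  have "\<mu> \<notin> op_spectrum T" if \<mu>: "\<mu> \<noteq> 0" "cmod \<mu> < c" for \<mu>
  proof -
    define L where "L x = T x - \<mu> *\<^sub>C x" for x
    have "\<exists>y. L y = x" for x
    proof -
      obtain u v where uv: "u \<in> M" "T v = 0" "x = u + v" using split by blast
      obtain y where "T y - \<mu> *\<^sub>C y = u"
        using bounded_below_surjective_perturb[OF linT M below0 surj, of \<mu> u] \<mu>(2) uv(1) by auto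
      then have "L (y + (- 1 / \<mu>) *\<^sub>C v) = x"
        unfolding L_def using \<mu>(1) uv
        by (simp add: linear_add[OF linT] linear_diff[OF linT] scT scaleC_add_right scaleC_diff_right
            scaleC_scaleC scaleC_minus_left algebra_simps)
      then show ?thesis by blast
    qed
    then obtain S where LS: "\<And>x. L (S x) = x" by metis
    have inj: "x = 0" if "L x = 0" for x
    proof -
      have Tx: "T x = \<mu> *\<^sub>C x" using that by (simp add: L_def)
      then have "(1 / \<mu>) *\<^sub>C T x = x" using \<mu>(1) by (simp add: scaleC_scaleC)
      then have "x \<in> M" using TM memM(4)[of "T x" "1 / \<mu>"] by auto
      then have "c * norm x \<le> cmod \<mu> * norm x" using below[of x] by (simp add: Tx norm_scaleC)
      then show ?thesis using \<mu>(2) by (metis mult_le_cancel_right norm_le_zero_iff not_less)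
    qed
    have Ldiff: "L (x - y) = L x - L y" for x y
      unfolding L_def by (simp add: linear_diff[OF linT] scaleC_diff_right)
    have SL: "S (L x) = x" for x using inj[of "S (L x) - x"] by (simp add: Ldiff LS)
    \<comment> \<open>Boundedness of the inverse is free, since the inverse of a multiplier is a multiplier.\<close>
    have "multiplier S"
      unfolding multiplier_def
    proof (intro allI)
      fix x y
      have "S x * L (S y) = L (S x) * S y"
        using T unfolding L_def multiplier_def
        by (simp add: left_diff_distrib right_diff_distrib mult_scaleC_left mult_scaleC_right)
      then show "S x * y = x * S y" by (simp add: LS)
    qed
    then have "bounded_clinear S" by (rule multiplier_bounded_clinear[OF ss])
    moreover have "S (T x - \<mu> *\<^sub>C x) = x" "T (S x) - \<mu> *\<^sub>C S x = x" for x
      using SL[of x] LS[of x] unfolding L_def by auto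
    ultimately show ?thesis unfolding op_spectrum_def by blast
  qed
  then show ?thesis
    unfolding generalized_drazin_invertible_def islimpt_approachable using c by (auto intro!: exI[of _ c])
qed

theorem proposition3p4:
  fixes T :: "'a::comm_complex_banach_algebra \<Rightarrow> 'a"
  assumes "semisimple_algebra TYPE('a)"
    and "regular_algebra TYPE('a)"
    and "tauberian_algebra TYPE('a)"
    and "multiplier T"
  shows "pseudo_fredholm T \<longleftrightarrow> generalized_drazin_invertible T"
  using pseudo_fredholm_imp_generalized_drazin[OF assms]
    generalized_drazin_imp_pseudo_fredholm[OF assms(1,4)] by blast

end
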